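(* Let $n\ge1$, $1<q<\infty$ and $\alpha>1$. There is a constant $C>0$ such that for every $f\in T^{1,q}(\gamma)$ there exist a sequence of scalars $(\lambda_k)_{k\ge1}\in\ell_1$ and a sequence $(a_k)_{k\ge1}$ of $T^{1,q}(\gamma)$ $\alpha$-atoms such that (i) $f=\sum_{k\ge1}\lambda_k a_k$ (convergence in $T^{1,q}(\gamma)$); (ii) $\sum_{k\ge1}|\lambda_k|\le C\,\|f\|_{T^{1,q}(\gamma)}$.
   Context: $\gamma$ is the standard Gaussian measure on $\mathbb{R}^n$, $d\gamma(x)=(2\pi)^{-n/2}\exp(-\frac12|x|^2)\,dx$. $q'=q/(q-1)$ is the conjugate exponent of $q$. $B(x,r)=\{y\in\mathbb{R}^n:|x-y|<r\}$, $m(x)=\min\{1,1/|x|\}$ (with $m(0)=1$), and for $\alpha>0$, $\mathscr{B}_\alpha=\{B(x,r):x\in\mathbb{R}^n,\ 0\le r\le\alpha m(x)\}$. Let $D=\{(x,t)\in\mathbb{R}^n\times(0,\infty): t<m(x)\}$. The Gaussian tent space $T^{1,q}(\gamma)$ is the completion of $C_{\rm c}(D)$ with respect to the norm $$\|f\|_{T^{1,q}(\gamma)}=\int_{\mathbb{R}^n}\Big(\iint_D\frac{\mathbf 1_{B(y,t)}(x)}{\gamma(B(y,t))}|f(y,t)|^q\,d\gamma(y)\frac{dt}{t}\Big)^{1/q}d\gamma(x),$$ i.e. $\|f\|_{T^{1,q}(\gamma)}=\|Jf\|_{L^1(\mathbb{R}^n,d\gamma(x);L^q(D,d\gamma(y)\frac{dt}{t}))}$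 with $(Jf(x))(y,t)=\frac{\mathbf 1_{B(y,t)}(x)}{\gamma(B(y,t))^{1/q}}f(y,t)$. Elements of $T^{1,q}(\gamma)$ are regarded as (a.e. equivalence classes of) measurable functions on $D$. For a measurable set $A\subseteq\mathbb{R}^n$, $T_1(A)=\{(y,t)\in\mathbb{R}^n\times(0,\infty): d(y,\complement A)\ge t\}$, where $\complement A=\mathbb{R}^n\setminus A$. For $\alpha>0$, a (measurable) function $a:D\to\mathbb{C}$ is a $T^{1,q}(\gamma)$ $\alpha$-atom if there is a ball $B\in\mathscr{B}_\alpha$ such that $a$ is supported in $T_1(B)\cap D$ and $\|a\|_{L^q(D,d\gamma\frac{dt}{t})}\le\gamma(B)^{-1/q'}$. *)

theory Defs
  imports "HOL-Analysis.Analysis"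
begin

definition gauss_measure :: "(real ^ 'n) measure" where
  "gauss_measure =
     density lborel (\<lambda>x. ennreal ((2 * pi) powr (- (real CARD('n) / 2)) * exp (- (norm x)\<^sup>2 / 2)))"

text \<open>The case distinction is needed because \<open>1 / 0 = 0\<close> in HOL.\<close>

definition adm :: "real ^ 'n \<Rightarrow> real" where
  "adm x = (if x = 0 then 1 else min 1 (1 / norm x))"

definition admissible_balls :: "real \<Rightarrow> (real ^ 'n) set set" where
  "admissible_balls \<alpha> = {ball x r |x r. 0 \<le> r \<and> r \<le> \<alpha> * adm x}"

definition tent_domain :: "((real ^ 'n) \<times> real) set" where
  "tent_domain = {(x, t). 0 < t \<and> t < adm x}"

text \<open>The measure \<open>d\<gamma>(y) dt/t\<close> on \<^const>\<open>tent_domain\<close>.\<close>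

definition tent_measure :: "((real ^ 'n) \<times> real) measure" where
  "tent_measure =
     restrict_space
       (gauss_measure \<Otimes>\<^sub>M density lborel (\<lambda>t. indicator {0<..} t * ennreal (1 / t)))
       tent_domain"

text \<open>Powers of \<open>[0,\<infinity>]\<close>-valued quantities with an exponent \<open>p > 0\<close>, so that \<open>\<infinity>\<close> is sent
  to \<open>\<infinity>\<close>.\<close>

definition epowr :: "ennreal \<Rightarrow> real \<Rightarrow> ennreal" where
  "epowr x p = (if x = \<infinity> then \<infinity> else ennreal (enn2real x powr p))"

text \<open>A function on \<^const>\<open>tent_domain\<close> is represented by a function on the whole product type,
  whose values outside \<^const>\<open>tent_domain\<close> are irrelevant.\<close>

definition tent_norm :: "real \<Rightarrow> ((real ^ 'n) \<times> real \<Rightarrow> complex) \<Rightarrow> ennreal" where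
  "tent_norm q f =
     (\<integral>\<^sup>+ x. epowr
        (\<integral>\<^sup>+ (y, t). ennreal (indicator (ball y t) x / measure gauss_measure (ball y t)
                            * norm (f (y, t)) powr q) \<partial>tent_measure)
        (1 / q) \<partial>gauss_measure)"

definition Cc_tent :: "((real ^ 'n) \<times> real \<Rightarrow> complex) set" where
  "Cc_tent = {g. continuous_on tent_domain g \<and>
     (\<exists>K. compact K \<and> K \<subseteq> tent_domain \<and> (\<forall>p\<in>tent_domain - K. g p = 0))}"

text \<open>The completion of \<^const>\<open>Cc_tent\<close>, realised by measurable functions on
  \<^const>\<open>tent_domain\<close>: since \<open>f \<mapsto> Jf\<close> is isometric into the Banach space
  \<open>L\<^sup>1(\<gamma>; L\<^sup>q(tent_measure))\<close>, whose limits of functions of the form \<open>Jf\<close> are again of that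
  form, the completion is the closure of \<^const>\<open>Cc_tent\<close> among the measurable functions.
  The elements of the set are representatives of the a.e. equivalence classes (Borel
  representatives, which every class has); two of them represent the same element iff their
  difference has \<^const>\<open>tent_norm\<close> zero, i.e. iff they agree a.e. on \<^const>\<open>tent_domain\<close>.\<close>

definition tent_space :: "real \<Rightarrow> ((real ^ 'n) \<times> real \<Rightarrow> complex) set" where
  "tent_space q = {f \<in> borel_measurable (restrict_space borel tent_domain).
     \<exists>g. (\<forall>k::nat. g k \<in> Cc_tent) \<and> (\<lambda>k. tent_norm q (\<lambda>p. f p - g k p)) \<longlonglongrightarrow> 0}"

text \<open>Convergence of a series \<^emph>\<open>in\<close> the tent space: terms and sum belong to the space.\<close>

definition tent_sums ::
  "real \<Rightarrow> (nat \<Rightarrow> (real ^ 'n) \<times> real \<Rightarrow> complex) \<Rightarrow> ((real ^ 'n) \<times> real \<Rightarrow> complex) \<Rightarrow> bool" where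
  "tent_sums q u f \<longleftrightarrow> f \<in> tent_space q \<and> (\<forall>k. u k \<in> tent_space q) \<and>
     (\<lambda>N. tent_norm q (\<lambda>p. f p - (\<Sum>k<N. u k p))) \<longlonglongrightarrow> 0"

text \<open>The first disjunct covers \<open>A = UNIV\<close>, where the distance to the complement is \<open>\<infinity>\<close>
  whereas \<^const>\<open>infdist\<close> to the empty set is \<open>0\<close>.\<close>

definition tent1 :: "(real ^ 'n) set \<Rightarrow> ((real ^ 'n) \<times> real) set" where
  "tent1 A = {(y, t). 0 < t \<and> (- A = {} \<or> t \<le> infdist y (- A))}"

text \<open>If \<open>B\<close> is empty (radius \<open>0\<close>), the bound below reads \<open>0\<close> instead of \<open>\<infinity>\<close>; this is
  immaterial, as then \<open>tent1 B = {}\<close> and the support condition already forces \<open>a = 0\<close>.\<close>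

definition tent_atom :: "real \<Rightarrow> real \<Rightarrow> ((real ^ 'n) \<times> real \<Rightarrow> complex) \<Rightarrow> bool" where
  "tent_atom q \<alpha> a \<longleftrightarrow>
     a \<in> borel_measurable (restrict_space borel tent_domain) \<and>
     (\<exists>B\<in>admissible_balls \<alpha>.
        (\<forall>p\<in>tent_domain. a p \<noteq> 0 \<longrightarrow> p \<in> tent1 B) \<and>
        epowr (\<integral>\<^sup>+ p. ennreal (norm (a p) powr q) \<partial>tent_measure) (1 / q)
          \<le> ennreal (measure gauss_measure B powr (- (1 / (q / (q - 1))))))"

end

theory Submission
  imports Defs "HOL-Probability.Distributions"
begin

text \<open>
  The proof is a stopping-time argument on dyadic cubes. Write \<open>A x\<close> for the inner \<open>L\<^sup>q\<close> norm in
  the definition of the tent norm, so that the norm of \<open>f\<close> is the integral of \<open>A\<close> against the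
  Gaussian measure \<open>\<gamma>\<close>. Two features make a purely dyadic argument possible. A point \<open>(y, t)\<close> of
  the domain has \<open>t < m(y)\<close>, and on balls of radius comparable to \<open>m\<close> at their centre the Gaussian
  density oscillates by a bounded factor only; hence at these scales \<open>\<gamma>\<close> is as doubling as Lebesgue
  measure. Also, a dyadic cube containing \<open>y\<close> of side a small multiple of \<open>t\<close> lies in the ball
  \<open>B(y,t)\<close> and has comparable measure (\<open>tile_geometry\<close>). So each \<open>(y, t)\<close> may be assigned such a
  cube, its tile, and the cone condition \<open>x \<in> B(y,t)\<close> may be replaced by membership in the tile.

  For an integer \<open>k\<close> call a tile heavy if more than half of it lies in the level set
  \<open>{A > 2^k}\<close>, and light otherwise. Points whose tile is heavy for \<open>k\<close> but not for \<open>k + 1\<close> are grouped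
  according to the maximal cube that is heavy for \<open>k\<close> and contains the tile. This cuts the domain
  into pieces indexed by \<open>k\<close> and a maximal heavy cube \<open>Q\<close>, and each piece carries a multiple of an atom:
  \<^item> Being light for \<open>k + 1\<close>, a tile meets the complement of \<open>{A > 2^(k+1)}\<close> in at least half of its
    measure. Fubini then bounds the integral of \<open>|f|\<^sup>q\<close> over the piece by that of \<open>A\<^sup>q\<close> over
    \<open>Q - {A > 2^(k+1)}\<close>, hence by a multiple of \<open>2^(kq) \<gamma>(Q)\<close> (\<open>tile_Carleson\<close>, \<open>piece_integral\<close>).
  \<^item> Being heavy for \<open>k\<close>, the disjoint maximal cubes satisfy \<open>\<gamma>(Q) < 2 \<gamma>(Q \<inter> {A > 2^k})\<close>, so
    their total measure is at most \<open>2 \<gamma>{A > 2^k}\<close> (\<open>top_heavy_sum\<close>). Summing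
    \<open>2^k \<gamma>{A > 2^k}\<close> over \<open>k\<close> gives back the tent norm up to a constant (\<open>weight_sum\<close>).
  \<^item> The points of a piece lie in the tent of one ball that has radius at most \<open>\<alpha> m\<close> at its
    centre and measure comparable to \<open>\<gamma>(Q)\<close> (\<open>atom_ball_exists\<close>). Here \<open>\<alpha> > 1\<close> is essential: \<open>t\<close> may be
    as large as \<open>m(y)\<close>, and the side of the cube has to be absorbed by the remaining room.

  Outside the pieces \<open>f\<close> vanishes almost everywhere: a tile heavy for every \<open>k\<close> would force \<open>A = \<infinity>\<close>
  on a set of positive measure although \<open>A\<close> is integrable, and where the tile is light for every \<open>k\<close> the Fubini bound gives
  \<open>f = 0\<close> (\<open>zero_off_pieces\<close>). Convergence of the series then follows by dominated convergence
  (\<open>tail_tendsto_0\<close>). That its terms, which are restrictions of \<open>f\<close> to Borel sets, belong to the closure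
  of \<open>C\<^sub>c(D)\<close> is a consequence of the regularity of finite Borel measures (\<open>tent_space_restrict\<close>).
\<close>

section \<open>The Gaussian measure and the admissibility function\<close>

definition gauss_density :: "real ^ 'n \<Rightarrow> real" where
  "gauss_density x = (2 * pi) powr (- (real CARD('n) / 2)) * exp (- (norm x)\<^sup>2 / 2)"

lemma gauss_density_pos: "gauss_density x > 0"
  by (simp add: gauss_density_def)

lemma gauss_density_measurable [measurable]: "gauss_density \<in> borel_measurable borel"
  unfolding gauss_density_def by measurable

lemma gauss_measure_density: "gauss_measure = density lborel (\<lambda>x. ennreal (gauss_density x))"
  by (simp add: gauss_measure_def gauss_density_def)

lemma space_gauss [simp]: "space gauss_measure = UNIV"
  by (simp add: gauss_measure_def)

lemma sets_gauss [simp, measurable_cong]: "sets gauss_measure = sets borel"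
  by (simp add: gauss_measure_def)

text \<open>With the given normalising constant the density is a product of one-dimensional standard normal
  densities, which reduces the total mass to the known integral on the line.\<close>

lemma gauss_density_prod:
  fixes x :: "real ^ 'n"
  shows "gauss_density x = (\<Prod>b\<in>Basis. std_normal_density (x \<bullet> b))"
proof -
  have d: "DIM(real^'n) = CARD('n)" by simp
  have "(\<Prod>b\<in>(Basis::(real^'n) set). std_normal_density (x \<bullet> b))
      = (1 / sqrt (2 * pi)) ^ CARD('n) * exp (\<Sum>b\<in>Basis. - (x \<bullet> b)\<^sup>2 / 2)"
    by (simp add: std_normal_density_def prod_dividef exp_sum d power_divide)
  also have "(\<Sum>b\<in>Basis. - (x \<bullet> b)\<^sup>2 / 2) = - (norm x)\<^sup>2 / 2"
  proof -
    have "(norm x)\<^sup>2 = (\<Sum>b\<in>Basis. (x \<bullet> b)\<^sup>2)"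
      unfolding power2_norm_eq_inner by (subst euclidean_inner) (simp only: power2_eq_square)
    then show ?thesis
      by (simp only: sum_divide_distrib[symmetric] sum_negf)
  qed
  also have "(1 / sqrt (2 * pi)) ^ CARD('n) = (2 * pi) powr (- (real CARD('n) / 2))"
  proof -
    have "(2 * pi) powr (1/2) = sqrt (2 * pi)"
      by (rule powr_half_sqrt) simp
    then have "1 / sqrt (2 * pi) = (2 * pi) powr (-(1/2))"
      by (simp only: powr_minus inverse_eq_divide)
    then have "(1 / sqrt (2 * pi)) ^ CARD('n) = ((2 * pi) powr (-(1/2))) powr (real CARD('n))"
      by (simp only: powr_realpow powr_gt_zero) (simp add: powr_realpow)
    also have "\<dots> = (2 * pi) powr (-(1/2) * real CARD('n))"
      by (simp only: powr_powr)
    also have "-(1/2) * real CARD('n) = - (real CARD('n) / 2)" by (rule minus_mult_left[symmetric, THEN trans]) simp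
    finally show ?thesis .
  qed
  finally show ?thesis by (simp add: gauss_density_def)
qed

lemma emeasure_gauss_UNIV: "emeasure (gauss_measure :: (real ^ 'n) measure) UNIV = 1"
proof -
  interpret N: prob_space "density lborel (\<lambda>x. ennreal (std_normal_density x))"
    by (rule prob_space_normal_density) simp
  have 1: "(\<integral>\<^sup>+x. ennreal (std_normal_density x) \<partial>lborel) = 1"
    using N.emeasure_space_1 by (simp add: emeasure_density)
  have "emeasure (gauss_measure :: (real ^ 'n) measure) UNIV
      = (\<integral>\<^sup>+x. (\<Prod>b\<in>Basis. ennreal (std_normal_density (x \<bullet> b))) \<partial>(lborel :: (real^'n) measure))"
    by (simp add: gauss_measure_density emeasure_density gauss_density_prod prod_ennreal)
  also have "\<dots> = (\<Prod>b\<in>(Basis::(real^'n) set). (\<integral>\<^sup>+x. ennreal (std_normal_density x) \<partial>lborel))"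
    by (rule nn_integral_lborel_prod) auto
  finally show ?thesis by (simp add: 1)
qed

interpretation gauss: prob_space gauss_measure
  by (rule prob_spaceI) (simp add: emeasure_gauss_UNIV)

lemma gauss_emeasure: "A \<in> sets borel \<Longrightarrow>
    emeasure gauss_measure A = (\<integral>\<^sup>+x. ennreal (gauss_density x) * indicator A x \<partial>lborel)"
  by (simp add: gauss_measure_density emeasure_density)

lemma gauss_open_pos: "open U \<Longrightarrow> U \<noteq> {} \<Longrightarrow> 0 < measure gauss_measure U"
proof -
  assume U: "open U" "U \<noteq> {}"
  have "emeasure gauss_measure U \<noteq> 0"
  proof
    assume "emeasure gauss_measure U = 0"
    then have "AE x in lborel. ennreal (gauss_density x) * indicator U x = 0"
      using U by (simp add: gauss_emeasure nn_integral_0_iff_AE)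
    then have "AE x in lborel. x \<notin> U"
    proof eventually_elim
      case (elim x)
      then show ?case
        using gauss_density_pos[of x] by (auto simp: ennreal_eq_0_iff)
    qed
    then have "U \<in> null_sets lborel"
      using U by (simp add: AE_iff_null_sets)
    then show False
      using open_not_negligible[OF U] by (simp add: negligible_iff_null_sets null_sets_completionI)
  qed
  then show ?thesis by (simp add: gauss.emeasure_eq_measure zero_less_measure_iff)
qed

text \<open>Without the case distinction, continuity and the elementary estimates are immediate.\<close>

lemma adm_eq: "adm x = 1 / max 1 (norm x)"
  by (auto simp: adm_def min_def max_def field_simps)

lemma adm_pos: "adm x > 0" by (simp add: adm_eq)

lemma adm_le_1: "adm x \<le> 1" by (simp add: adm_eq)

lemma adm_norm_le_1: "adm x * norm x \<le> 1" by (simp add: adm_eq field_simps)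

lemma continuous_adm: "continuous_on A adm"
  unfolding adm_eq[abs_def] by (intro continuous_intros) auto

lemma adm_measurable [measurable]: "adm \<in> borel_measurable borel"
  by (intro borel_measurable_continuous_onI continuous_adm)

text \<open>The function \<open>m\<close> varies slowly: its reciprocal \<open>max 1 |x|\<close> is 1-Lipschitz and at least \<open>1\<close>. This is how the
  restriction \<open>t < m(y)\<close> is transferred from a point to the centre of a nearby ball.\<close>

lemma adm_slow: "adm y \<le> (1 + norm (y - x)) * adm x"
proof -
  have "norm x \<le> norm y + norm (y - x)"
    by (metis norm_minus_commute norm_triangle_sub)
  then have "max 1 (norm x) \<le> max 1 (norm y) + norm (y - x)"
    using norm_ge_zero[of "y - x"] by linarith
  also have "\<dots> \<le> max 1 (norm y) + max 1 (norm y) * norm (y - x)"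
    by (simp add: mult_le_cancel_right1)
  finally have "max 1 (norm x) \<le> max 1 (norm y) * (1 + norm (y - x))"
    by (simp add: distrib_left)
  then show ?thesis
    by (simp add: adm_eq field_simps)
qed

text \<open>On a ball of radius \<open>\<rho> m(y)\<close> about \<open>y\<close> the exponent \<open>|x|\<^sup>2 / 2\<close> changes by a bounded amount
  only, because \<open>| |x|\<^sup>2 - |y|\<^sup>2 | \<le> |x - y| (2 |y| + |x - y|)\<close> and \<open>m(y) |y| \<le> 1\<close>.\<close>

lemma gauss_density_comparable:
  assumes "norm (x - y) \<le> \<rho> * adm y" "0 \<le> \<rho>"
  shows "gauss_density x \<le> exp (\<rho> * (2 + \<rho>) / 2) * gauss_density y"
    and "gauss_density y \<le> exp (\<rho> * (2 + \<rho>) / 2) * gauss_density x"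
proof -
  have "\<bar>(norm x)\<^sup>2 - (norm y)\<^sup>2\<bar> \<le> \<rho> * (2 + \<rho>)"
  proof -
    have 1: "\<bar>norm x - norm y\<bar> \<le> norm (x - y)" by (rule norm_triangle_ineq3)
    have "\<bar>(norm x)\<^sup>2 - (norm y)\<^sup>2\<bar> = \<bar>norm x - norm y\<bar> * (norm x + norm y)"
      by (simp add: square_diff_square_factored power2_eq_square abs_mult mult.commute)
    also have "\<dots> \<le> norm (x - y) * (norm x + norm y)"
      using 1 by (intro mult_right_mono) auto
    also have "\<dots> \<le> norm (x - y) * (2 * norm y + norm (x - y))"
      using 1 by (intro mult_left_mono) auto
    also have "\<dots> \<le> (\<rho> * adm y) * (2 * norm y + \<rho> * adm y)"
      using assms adm_pos[of y] by (intro mult_mono) auto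
    also have "\<dots> = \<rho> * (2 * (adm y * norm y) + \<rho> * (adm y * adm y))"
      by (simp add: algebra_simps)
    also have "\<dots> \<le> \<rho> * (2 * 1 + \<rho> * (1 * 1))"
      using adm_norm_le_1[of y] adm_le_1[of y] adm_pos[of y] assms(2)
      by (intro mult_left_mono add_mono mult_mono) auto
    finally show ?thesis by simp
  qed
  then have "- (norm x)\<^sup>2 / 2 \<le> \<rho> * (2 + \<rho>) / 2 + (- (norm y)\<^sup>2 / 2)"
    and "- (norm y)\<^sup>2 / 2 \<le> \<rho> * (2 + \<rho>) / 2 + (- (norm x)\<^sup>2 / 2)"
    by (simp_all add: abs_le_iff)
  then have "exp (- (norm x)\<^sup>2 / 2) \<le> exp (\<rho> * (2 + \<rho>) / 2) * exp (- (norm y)\<^sup>2 / 2)"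
    and "exp (- (norm y)\<^sup>2 / 2) \<le> exp (\<rho> * (2 + \<rho>) / 2) * exp (- (norm x)\<^sup>2 / 2)"
    by (simp_all only: exp_add[symmetric] exp_le_cancel_iff)
  then show "gauss_density x \<le> exp (\<rho> * (2 + \<rho>) / 2) * gauss_density y"
    and "gauss_density y \<le> exp (\<rho> * (2 + \<rho>) / 2) * gauss_density x"
    by (simp_all add: gauss_density_def mult.left_commute mult_left_mono)
qed

section \<open>The measure on the domain of the tent space\<close>

lemma tent_domain_sets [measurable]: "(tent_domain :: ((real ^ 'n) \<times> real) set) \<in> sets borel"
proof -
  have "(tent_domain :: ((real ^ 'n) \<times> real) set) = {p \<in> space (borel \<Otimes>\<^sub>M borel). 0 < snd p \<and> snd p < adm (fst p)}"
    by (auto simp: tent_domain_def space_pair_measure)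
  also have "\<dots> \<in> sets (borel \<Otimes>\<^sub>M borel)" by measurable
  finally show ?thesis using borel_prod[where 'a="real^'n" and 'b=real] by (simp only:)
qed

text \<open>The product measure before restriction to the domain. Its \<open>\<sigma>\<close>-algebra is the full Borel
  \<open>\<sigma>\<close>-algebra, so that product and regularity results can be applied to it directly.\<close>

definition tent_base :: "((real ^ 'n) \<times> real) measure" where
  "tent_base = gauss_measure \<Otimes>\<^sub>M density lborel (\<lambda>t. indicator {0<..} t * ennreal (1 / t))"

lemma sets_tent_base [simp, measurable_cong]: "sets tent_base = sets borel"
  unfolding tent_base_def by (subst borel_prod[symmetric]) (rule sets_pair_measure_cong, auto)

lemma space_tent_base [simp]: "space tent_base = UNIV"
  by (simp add: tent_base_def space_pair_measure)

lemma tent_measure_eq: "tent_measure = restrict_space tent_base tent_domain"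
  by (simp add: tent_measure_def tent_base_def)

lemma space_tent [simp]: "space tent_measure = tent_domain"
  by (simp add: tent_measure_eq space_restrict_space)

lemma sets_tent [measurable_cong]: "sets tent_measure = sets (restrict_space borel tent_domain)"
  unfolding tent_measure_eq by (rule sets_restrict_space_cong) simp

lemma sigma_finite_dt_t:
  "sigma_finite_measure (density lborel (\<lambda>t::real. indicator {0<..} t * ennreal (1 / t)))"
  by (subst sigma_finite_measure.sigma_finite_iff_density_finite[OF sigma_finite_lborel])
    (auto simp: ennreal_mult_eq_top_iff intro!: AE_I2 split: split_indicator)

lemma sigma_finite_tent_base: "sigma_finite_measure tent_base"
  unfolding tent_base_def
proof -
  interpret t: sigma_finite_measure "density lborel (\<lambda>t::real. indicator {0<..} t * ennreal (1 / t))"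
    by (rule sigma_finite_dt_t)
  interpret pair_sigma_finite gauss_measure "density lborel (\<lambda>t::real. indicator {0<..} t * ennreal (1 / t))" ..
  show "sigma_finite_measure (gauss_measure \<Otimes>\<^sub>M density lborel (\<lambda>t. indicator {0<..} t * ennreal (1 / t)))" ..
qed

interpretation tent: sigma_finite_measure tent_measure
  unfolding tent_measure_eq
  by (rule sigma_finite_measure_restrict_space[OF sigma_finite_tent_base]) simp

interpretation gt: pair_sigma_finite gauss_measure tent_measure ..

lemma fst_measurable_prod [measurable]: "fst \<in> borel_measurable (borel :: ((real ^ 'n) \<times> real) measure)"
  by (intro borel_measurable_continuous_onI continuous_intros)

lemma snd_measurable_prod [measurable]: "snd \<in> borel_measurable (borel :: ((real ^ 'n) \<times> real) measure)"
  by (intro borel_measurable_continuous_onI continuous_intros)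

text \<open>The next facts reduce measurability on the domain to measurability on the product
  space.\<close>

lemma id_measurable_tent: "(\<lambda>p. p) \<in> measurable tent_measure borel"
  by (subst measurable_cong_sets[OF sets_tent refl]) (rule measurable_restrict_space1, simp)

lemma fst_measurable_tent [measurable]:
    "fst \<in> measurable (tent_measure :: ((real ^ 'n) \<times> real) measure) borel"
  and snd_measurable_tent [measurable]:
    "snd \<in> measurable (tent_measure :: ((real ^ 'n) \<times> real) measure) borel"
  using measurable_compose[OF id_measurable_tent fst_measurable_prod]
    measurable_compose[OF id_measurable_tent snd_measurable_prod] by simp_all

lemma borel_measurable_tent:
  "f \<in> borel_measurable tent_measure \<longleftrightarrow> f \<in> borel_measurable (restrict_space borel tent_domain)"
  by (simp add: measurable_cong_sets[OF sets_tent refl])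

lemma tent_sets_Int: "P \<in> sets borel \<Longrightarrow> tent_domain \<inter> P \<in> sets tent_measure"
  by (auto simp: sets_tent sets_restrict_space)

text \<open>On a compact part of the domain \<open>t\<close> is bounded away from \<open>0\<close>, where \<open>dt / t\<close> has its only
  singularity.\<close>

lemma tent_compact_finite:
  fixes K :: "((real ^ 'n) \<times> real) set"
  assumes K: "compact K" "K \<subseteq> tent_domain"
  shows "emeasure tent_measure K < \<infinity>"
proof (cases "K = {}")
  case False
  have "continuous_on K snd" by (intro continuous_intros)
  from continuous_attains_inf[OF K(1) False this] obtain p0
    where p0: "p0 \<in> K" "\<And>p. p \<in> K \<Longrightarrow> snd p0 \<le> snd p" by blast
  define e where "e = snd p0"
  have e: "0 < e" using p0 K by (auto simp: e_def tent_domain_def)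
  have sub: "K \<subseteq> UNIV \<times> {e..1}"
  proof
    fix p assume p: "p \<in> K"
    then have "snd p < adm (fst p)" using K by (auto simp: tent_domain_def)
    with p0(2)[OF p] adm_le_1[of "fst p"] show "p \<in> UNIV \<times> {e..1}"
      by (cases p) (auto simp: e_def)
  qed
  let ?d = "density lborel (\<lambda>t::real. indicator {0<..} t * ennreal (1 / t))"
  interpret t: sigma_finite_measure ?d by (rule sigma_finite_dt_t)
  have "emeasure tent_measure K = emeasure tent_base K"
    unfolding tent_measure_eq using K by (intro emeasure_restrict_space) auto
  also have "\<dots> \<le> emeasure tent_base ((UNIV :: (real ^ 'n) set) \<times> {e..1})"
    by (rule emeasure_mono[OF sub]) (auto intro!: borel_closed closed_Times)
  also have "\<dots> = emeasure (gauss_measure :: (real ^ 'n) measure) UNIV * emeasure ?d {e..1}"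
    unfolding tent_base_def by (rule t.emeasure_pair_measure_Times) auto
  also have "emeasure ?d {e..1} = (\<integral>\<^sup>+ t. indicator {0<..} t * ennreal (1 / t) * indicator {e..1} t \<partial>lborel)"
    by (rule emeasure_density) auto
  also have "\<dots> \<le> (\<integral>\<^sup>+ t. ennreal (1 / e) * indicator {e..1} t \<partial>lborel)"
    using e by (intro nn_integral_mono) (auto split: split_indicator intro!: ennreal_leI divide_left_mono)
  also have "\<dots> = ennreal (1 / e) * emeasure lborel {e..1}"
    by (rule nn_integral_cmult_indicator) simp
  also have "\<dots> < \<infinity>"
    by (cases "e \<le> 1") (auto simp: ennreal_mult_less_top)
  finally show ?thesis by (simp add: emeasure_gauss_UNIV mult_left_mono)
qed simp

section \<open>Dyadic cubes at admissible scales\<close>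

text \<open>The index of the half-open dyadic cube of side \<open>1 / 2 ^ i\<close> that contains \<open>y\<close>.\<close>

definition cell :: "nat \<Rightarrow> real ^ 'n \<Rightarrow> int ^ 'n" where
  "cell i y = (\<chi> k. \<lfloor>2 ^ i * y $ k\<rfloor>)"

definition cube :: "nat \<Rightarrow> int ^ 'n \<Rightarrow> (real ^ 'n) set" where
  "cube i v = {y. cell i y = v}"

text \<open>Dyadic cubes are nested: the coarse index is obtained from the fine one by integer division
  by a power of two.\<close>

lemma cell_coarsen:
  assumes "i \<le> j" "cell j x = cell j y"
  shows "cell i x = cell i y"
proof -
  have *: "\<lfloor>2 ^ i * z\<rfloor> = \<lfloor>2 ^ j * z\<rfloor> div 2 ^ (j - i)" for z :: real
  proof -
    have "\<lfloor>2 ^ j * z\<rfloor> div 2 ^ (j - i) = \<lfloor>2 ^ j * z / real_of_int (2 ^ (j - i))\<rfloor>"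
      by (rule floor_divide_real_eq_div[symmetric]) simp
    also have "2 ^ j * z / real_of_int (2 ^ (j - i)) = 2 ^ i * z"
      using assms(1) by (simp add: field_simps flip: power_add)
    finally show ?thesis by simp
  qed
  show ?thesis
    using assms(2) by (simp add: cell_def vec_eq_iff *)
qed

lemma cube_sets [measurable]:
  fixes v :: "int ^ 'n"
  shows "cube i v \<in> sets borel"
proof -
  have [measurable]: "(\<lambda>y :: real ^ 'n. y $ k) \<in> borel_measurable borel" for k :: 'n
    by (intro borel_measurable_continuous_onI continuous_intros)
  have "cube i v = {y \<in> space borel. \<forall>k\<in>UNIV. \<lfloor>2 ^ i * y $ k\<rfloor> = v $ k}"
    by (auto simp: cube_def cell_def vec_eq_iff)
  also have "\<dots> \<in> sets borel" by measurable
  finally show ?thesis .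
qed

lemma cell_measurable [measurable]: "cell i \<in> measurable borel (count_space UNIV)"
proof (subst measurable_count_space_eq2_countable, intro conjI ballI)
  show "cell i -` {a} \<inter> space borel \<in> sets borel" for a :: "int ^ 'n"
    using cube_sets[of i a] by (simp add: cube_def vimage_def)
qed auto

lemma cube_diameter:
  fixes x y :: "real ^ 'n"
  assumes "cell i x = cell i y"
  shows "norm (x - y) \<le> real CARD('n) / 2 ^ i"
proof -
  have "\<bar>(x - y) $ k\<bar> \<le> 1 / 2 ^ i" for k
  proof -
    have "\<lfloor>2 ^ i * x $ k\<rfloor> = \<lfloor>2 ^ i * y $ k\<rfloor>"
      using assms by (simp add: cell_def vec_eq_iff)
    then have "\<bar>2 ^ i * x $ k - 2 ^ i * y $ k\<bar> \<le> 1" by linarith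
    also have "2 ^ i * x $ k - 2 ^ i * y $ k = 2 ^ i * (x - y) $ k" by (simp add: algebra_simps)
    finally show ?thesis by (simp only: abs_mult) (simp add: field_simps del: vector_minus_component)
  qed
  then have "(\<Sum>k\<in>UNIV. \<bar>(x - y) $ k\<bar>) \<le> (\<Sum>k\<in>(UNIV::'n set). 1 / 2 ^ i)"
    by (intro sum_mono) auto
  then show ?thesis
    using norm_le_l1_cart[of "x - y"] by simp
qed

lemma inner_const_vec_Basis:
  "b \<in> (Basis :: (real ^ 'n) set) \<Longrightarrow> (\<chi> k. s) \<bullet> b = s"
  by (auto simp: Basis_vec_def inner_axis)

text \<open>A dyadic cube contains an open box of this kind and a ball is contained in a closed one, which
  gives the two volume bounds that follow.\<close>

lemma lborel_box_side:
  fixes y :: "real ^ 'n"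
  assumes "0 \<le> s"
  shows "emeasure lborel (box y (y + (\<chi> k. s))) = ennreal (s ^ CARD('n))"
    and "emeasure lborel (cbox y (y + (\<chi> k. s))) = ennreal (s ^ CARD('n))"
  using assms by (auto simp: inner_const_vec_Basis inner_add_left)

lemma cube_volume:
  fixes v :: "int ^ 'n"
  shows "ennreal ((1 / 2 ^ i) ^ CARD('n)) \<le> emeasure lborel (cube i v)"
proof -
  define y :: "real ^ 'n" where "y = (\<chi> k. of_int (v $ k) / 2 ^ i)"
  have "box y (y + (\<chi> k. 1 / 2 ^ i)) \<subseteq> cube i v"
  proof
    fix z assume "z \<in> box y (y + (\<chi> k. 1 / 2 ^ i))"
    then have z: "of_int (v $ k) / 2 ^ i < z $ k \<and> z $ k < of_int (v $ k) / 2 ^ i + 1 / 2 ^ i" for k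
      by (simp add: mem_box_cart y_def)
    have "\<lfloor>2 ^ i * z $ k\<rfloor> = v $ k" for k
      using z[of k] by (intro floor_unique) (auto simp: field_simps)
    then show "z \<in> cube i v" by (simp add: cube_def cell_def vec_eq_iff)
  qed
  then have "emeasure lborel (box y (y + (\<chi> k. 1 / 2 ^ i))) \<le> emeasure lborel (cube i v)"
    by (intro emeasure_mono) auto
  then show ?thesis by (subst (asm) lborel_box_side) auto
qed

lemma ball_volume:
  fixes y :: "real ^ 'n"
  assumes "0 \<le> r"
  shows "emeasure lborel (ball y r) \<le> ennreal ((2 * r) ^ CARD('n))"
proof -
  have "ball y r \<subseteq> cbox (y - (\<chi> k. r)) (y - (\<chi> k. r) + (\<chi> k. 2 * r))"
  proof
    fix z assume "z \<in> ball y r"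
    then have "\<bar>(y - z) $ k\<bar> \<le> r" for k
      using component_le_norm_cart[of "y - z" k] by (simp add: dist_norm)
    then show "z \<in> cbox (y - (\<chi> k. r)) (y - (\<chi> k. r) + (\<chi> k. 2 * r))"
      by (auto simp: mem_box_cart abs_le_iff algebra_simps)
  qed
  then have "emeasure lborel (ball y r) \<le> emeasure lborel (cbox (y - (\<chi> k. r)) (y - (\<chi> k. r) + (\<chi> k. 2 * r)))"
    by (intro emeasure_mono) auto
  then show ?thesis by (subst (asm) lborel_box_side) (use assms in auto)
qed

text \<open>The doubling property at admissible scales, in the form in which it is used: a ball whose radius
  is at most a multiple of \<open>m(y)\<close> and of the side of a small dyadic cube containing its centre has
  measure at most a multiple of the measure of the cube. Both measures are compared with
  \<open>gauss_density y\<close> times a Lebesgue volume.\<close>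

lemma ball_le_cube:
  fixes y :: "real ^ 'n"
  assumes "1 \<le> \<rho>" and small: "real CARD('n) / 2 ^ i \<le> adm y"
    and r: "0 \<le> r" "r \<le> \<rho> * adm y" "r \<le> \<kappa> / 2 ^ i"
  shows "measure gauss_measure (ball y r)
    \<le> exp (\<rho> * (2 + \<rho>)) * (2 * \<kappa>) ^ CARD('n) * measure gauss_measure (cube i (cell i y))"
proof -
  define E where "E = exp (\<rho> * (2 + \<rho>) / 2)"
  define g where "g = gauss_density y"
  define V where "V = (1 / 2 ^ i :: real) ^ CARD('n)"
  have E: "E > 0" "exp (\<rho> * (2 + \<rho>)) = E * E" and g: "g > 0" and V: "V > 0"
    by (simp_all add: E_def g_def gauss_density_pos V_def flip: exp_add)
  have \<kappa>: "0 \<le> \<kappa>"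
    using order_trans[OF r(1,3)] by (simp add: pos_le_divide_eq)
  have "emeasure gauss_measure (ball y r)
      = (\<integral>\<^sup>+x. ennreal (gauss_density x) * indicator (ball y r) x \<partial>lborel)"
    by (rule gauss_emeasure) simp
  also have "\<dots> \<le> (\<integral>\<^sup>+x. ennreal (E * g) * indicator (ball y r) x \<partial>lborel)"
    unfolding E_def g_def
    using r assms(1)
    by (intro nn_integral_mono)
       (auto split: split_indicator simp: dist_norm norm_minus_commute intro!: ennreal_leI gauss_density_comparable(1))
  also have "\<dots> = ennreal (E * g) * emeasure lborel (ball y r)"
    by (rule nn_integral_cmult_indicator) simp
  also have "\<dots> \<le> ennreal (E * g) * ennreal ((2 * r) ^ CARD('n))"
    by (intro mult_left_mono ball_volume r) auto
  also have "\<dots> = ennreal (E * g * (2 * r) ^ CARD('n))"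
    using E g r by (simp add: ennreal_mult)
  finally have 1: "measure gauss_measure (ball y r) \<le> E * g * (2 * r) ^ CARD('n)"
    using E g r by (simp add: gauss.emeasure_eq_measure)
  also have "\<dots> \<le> E * g * (2 * (\<kappa> / 2 ^ i)) ^ CARD('n)"
    using E g r by (intro mult_left_mono power_mono) auto
  also have "\<dots> = E * g * (2 * \<kappa>) ^ CARD('n) * V"
    by (simp add: V_def power_mult_distrib power_divide)
  finally have 2: "measure gauss_measure (ball y r) \<le> E * g * (2 * \<kappa>) ^ CARD('n) * V" .
  have "ennreal (g / E * V) = ennreal (g / E) * ennreal V"
    using E g V by (intro ennreal_mult) auto
  also have "\<dots> \<le> ennreal (g / E) * emeasure lborel (cube i (cell i y))"
    unfolding V_def by (intro mult_left_mono cube_volume) auto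
  also have "\<dots> = (\<integral>\<^sup>+x. ennreal (g / E) * indicator (cube i (cell i y)) x \<partial>lborel)"
    by (rule nn_integral_cmult_indicator[symmetric]) simp
  also have "\<dots> \<le> (\<integral>\<^sup>+x. ennreal (gauss_density x) * indicator (cube i (cell i y)) x \<partial>lborel)"
  proof (intro nn_integral_mono)
    fix x
    have "g / E \<le> gauss_density x" if "x \<in> cube i (cell i y)"
    proof -
      have "norm (x - y) \<le> real CARD('n) / 2 ^ i"
        using that by (intro cube_diameter) (simp add: cube_def)
      also have "\<dots> \<le> 1 * adm y" using small by simp
      also have "\<dots> \<le> \<rho> * adm y" using assms(1) adm_pos[of y] by (intro mult_right_mono) auto
      finally have "g \<le> E * gauss_density x"
        unfolding E_def g_def using assms(1) by (intro gauss_density_comparable(2)) auto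
      then show ?thesis using E by (simp add: field_simps)
    qed
    then show "ennreal (g / E) * indicator (cube i (cell i y)) x
        \<le> ennreal (gauss_density x) * indicator (cube i (cell i y)) x"
      by (auto split: split_indicator intro!: ennreal_leI)
  qed
  also have "\<dots> = emeasure gauss_measure (cube i (cell i y))"
    by (rule gauss_emeasure[symmetric]) simp
  finally have "g / E * V \<le> measure gauss_measure (cube i (cell i y))"
    by (simp add: gauss.emeasure_eq_measure)
  then have "g * V \<le> E * measure gauss_measure (cube i (cell i y))"
    using E by (simp add: field_simps)
  then have "(E * (2 * \<kappa>) ^ CARD('n)) * (g * V)
      \<le> (E * (2 * \<kappa>) ^ CARD('n)) * (E * measure gauss_measure (cube i (cell i y)))"
    using E \<kappa> by (intro mult_left_mono) auto
  moreover have "E * g * (2 * \<kappa>) ^ CARD('n) * V = (E * (2 * \<kappa>) ^ CARD('n)) * (g * V)"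
    by (simp only: mult_ac)
  moreover have "exp (\<rho> * (2 + \<rho>)) * (2 * \<kappa>) ^ CARD('n) * measure gauss_measure (cube i (cell i y))
      = (E * (2 * \<kappa>) ^ CARD('n)) * (E * measure gauss_measure (cube i (cell i y)))"
    by (simp only: E mult_ac)
  ultimately show ?thesis using 2 by linarith
qed

section \<open>Roots of extended nonnegative reals\<close>

lemma epowr_mono: "x \<le> y \<Longrightarrow> 0 < p \<Longrightarrow> epowr x p \<le> epowr y p"
  by (auto simp: epowr_def top_unique less_top intro!: ennreal_leI powr_mono2 enn2real_mono)

lemma epowr_ennreal: "0 \<le> a \<Longrightarrow> epowr (ennreal a) p = ennreal (a powr p)"
  by (simp add: epowr_def)

lemma epowr_top [simp]: "epowr top p = top"
  by (simp add: epowr_def)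

lemma epowr_0 [simp]: "epowr 0 p = 0"
  by (simp add: epowr_def)

lemma epowr_measurable [measurable]: "(\<lambda>x. epowr x p) \<in> borel_measurable borel"
  unfolding epowr_def by measurable

text \<open>A triangle inequality up to a constant, which is enough for all limit arguments: \<open>x + y\<close> is at
  most twice the larger summand, so \<open>z\<close> is at most \<open>4 powr q\<close> times that summand.\<close>

lemma epowr_add_le:
  assumes q: "1 < q" and z: "z \<le> ennreal (2 powr q) * (x + y)"
  shows "epowr z (1 / q) \<le> 4 * (epowr x (1 / q) + epowr y (1 / q))"
proof -
  have *: "epowr z (1 / q) \<le> 4 * epowr x (1 / q)" if "y \<le> x" "z \<le> ennreal (2 powr q) * (x + y)" for x y
  proof (cases x)
    case top
    then show ?thesis by (simp add: ennreal_mult_top)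
  next
    case (real a)
    have "z \<le> ennreal (2 powr q) * (x + x)"
      using that by (meson add_left_mono mult_left_mono order_trans zero_le)
    also have "\<dots> = ennreal (2 powr q * (a + a))"
      using real by (simp add: ennreal_mult ennreal_plus del: mult_2 flip: mult_2)
    also have "\<dots> \<le> ennreal (4 powr q * a)"
    proof (intro ennreal_leI)
      have "2 powr q * (a + a) = (2 powr q * 2 powr 1) * a" by simp
      also have "\<dots> \<le> (2 powr q * 2 powr q) * a"
        using q real by (intro mult_right_mono mult_left_mono powr_mono) auto
      also have "2 powr q * 2 powr q = (4::real) powr q" by (simp flip: powr_mult)
      finally show "2 powr q * (a + a) \<le> 4 powr q * a" .
    qed
    finally have "epowr z (1 / q) \<le> epowr (ennreal (4 powr q * a)) (1 / q)"
      using q by (intro epowr_mono) auto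
    also have "\<dots> = ennreal (4 * a powr (1 / q))"
      using q real by (simp add: epowr_ennreal powr_mult powr_powr)
    finally show ?thesis
      using real by (simp add: epowr_ennreal ennreal_mult)
  qed
  show ?thesis
  proof (cases "y \<le> x")
    case True
    from *[OF this z] show ?thesis
      by (rule order_trans) (simp add: distrib_left)
  next
    case False
    with *[of x y] z have "epowr z (1 / q) \<le> 4 * epowr y (1 / q)" by (simp add: add.commute)
    then show ?thesis by (rule order_trans) (simp add: distrib_left)
  qed
qed

text \<open>A Young-type inequality. Applied with \<open>G = A\<^sup>q\<close>, it compares the integral of \<open>A\<close> over a
  probability space with that of \<open>A\<^sup>q\<close>; as \<open>\<epsilon>\<close> is free, smallness of the latter implies
  smallness of the former.\<close>

lemma epowr_root_le:
  assumes q: "1 < q" and \<epsilon>: "0 < \<epsilon>"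
  shows "epowr G (1 / q) \<le> ennreal \<epsilon> + ennreal (\<epsilon> powr (1 - q)) * G"
proof (cases G)
  case top
  then show ?thesis using \<epsilon> by (simp add: ennreal_mult_top)
next
  case (real a)
  have "a powr (1 / q) \<le> \<epsilon> + \<epsilon> powr (1 - q) * a"
  proof (cases "a \<le> \<epsilon> powr q")
    case True
    have "a powr (1 / q) \<le> (\<epsilon> powr q) powr (1 / q)"
      using True q real by (intro powr_mono2) auto
    also have "\<dots> = \<epsilon>" using q \<epsilon> by (simp add: powr_powr)
    finally show ?thesis using real by (smt (verit) mult_nonneg_nonneg powr_ge_zero)
  next
    case False
    have "0 < \<epsilon> powr q" using \<epsilon> by simp
    then have a: "0 < a" using False by linarith
    have "a powr (1 / q) = a powr (1 / q - 1) * a"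
      using a by (simp add: powr_diff)
    also have "\<dots> \<le> (\<epsilon> powr q) powr (1 / q - 1) * a"
      using False q \<epsilon> a by (intro mult_right_mono powr_mono2') auto
    also have "(\<epsilon> powr q) powr (1 / q - 1) = \<epsilon> powr (1 - q)"
      using q by (simp add: powr_powr right_diff_distrib)
    finally show ?thesis using \<epsilon> by simp
  qed
  then have "epowr G (1 / q) \<le> ennreal (\<epsilon> + \<epsilon> powr (1 - q) * a)"
    using real by (simp add: epowr_ennreal ennreal_leI)
  also have "\<dots> = ennreal \<epsilon> + ennreal (\<epsilon> powr (1 - q)) * G"
    using real \<epsilon> by (simp add: ennreal_mult)
  finally show ?thesis .
qed

lemma epowr_le_D:
  assumes "epowr z (1 / q) \<le> ennreal b" "1 < q" "0 \<le> b"
  shows "z \<le> ennreal (b powr q)"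
proof (cases z)
  case (real a)
  with assms have "a powr (1 / q) \<le> b" by (simp add: epowr_ennreal)
  then have "(a powr (1 / q)) powr q \<le> b powr q"
    using assms by (intro powr_mono2) auto
  then show ?thesis using real assms by (simp add: powr_powr ennreal_leI)
qed (use assms in \<open>simp add: top_unique\<close>)

lemma epowr_inverse_le:
  assumes "z \<le> ennreal (b powr q)" "1 < q" "0 \<le> b"
  shows "epowr z (1 / q) \<le> ennreal b"
proof -
  have "epowr z (1 / q) \<le> epowr (ennreal (b powr q)) (1 / q)"
    using assms by (intro epowr_mono) auto
  also have "\<dots> = ennreal b" using assms by (simp add: epowr_ennreal powr_powr)
  finally show ?thesis .
qed

lemma epowr_eq_0_iff: "0 < p \<Longrightarrow> epowr z p = 0 \<longleftrightarrow> z = 0"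
  by (cases z) (auto simp: epowr_ennreal ennreal_eq_0_iff powr_def)

lemma epowr_root_tendsto_0:
  assumes u: "(u \<longlongrightarrow> 0) F" and q: "1 < q"
  shows "((\<lambda>x. epowr (u x) (1 / q)) \<longlongrightarrow> 0) F"
proof (rule order_tendstoI)
  fix a :: ennreal assume "0 < a"
  then obtain b where b: "0 < b" "b < a" using dense by blast
  then have "b < top" using less_top_ennreal by (metis less_trans not_less top_greatest order_le_less_trans)
  then obtain r where r: "b = ennreal r" "0 \<le> r" by (cases b) auto
  with b have "0 < r" by simp
  then have "0 < ennreal (r powr q)" by simp
  with u have "eventually (\<lambda>x. u x < ennreal (r powr q)) F" by (rule order_tendstoD)
  then show "eventually (\<lambda>x. epowr (u x) (1 / q) < a) F"
  proof eventually_elim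
    case (elim x)
    then have "epowr (u x) (1 / q) \<le> ennreal r"
      using q r by (intro epowr_inverse_le) auto
    then show ?case using b r by simp
  qed
qed simp

text \<open>A geometric series: if \<open>2 powr K\<close> is the largest integer power of two below \<open>a\<close>, all of them add up to
  \<open>2 * 2 powr K\<close>.\<close>

lemma dyadic_sum_le:
  "(\<integral>\<^sup>+ k. ennreal (2 powr real_of_int k) * indicator {k. ennreal (2 powr real_of_int k) < a} k \<partial>count_space UNIV) \<le> 2 * a"
proof (cases a)
  case top
  then show ?thesis by (simp add: ennreal_mult_top)
next
  case (real r)
  show ?thesis
  proof (cases "r = 0")
    case True
    then show ?thesis using real by simp
  next
    case False
    with real have r: "0 < r" by simp
    define K where "K = \<lceil>log 2 r\<rceil> - 1"
    have iff: "2 powr real_of_int k < r \<longleftrightarrow> k \<le> K" for k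
    proof -
      have "2 powr real_of_int k < r \<longleftrightarrow> real_of_int k < log 2 r"
        using r by (simp add: less_log_iff)
      also have "\<dots> \<longleftrightarrow> k \<le> K" unfolding K_def by linarith
      finally show ?thesis .
    qed
    have bij: "bij_betw (\<lambda>n. K - int n) UNIV {..K}"
      by (rule bij_betwI[where g = "\<lambda>k. nat (K - k)"]) auto
    have "(\<integral>\<^sup>+ k. ennreal (2 powr real_of_int k) * indicator {k. ennreal (2 powr real_of_int k) < a} k \<partial>count_space UNIV)
       = (\<integral>\<^sup>+ k. ennreal (2 powr real_of_int k) * indicator {..K} k \<partial>count_space UNIV)"
      using real by (intro nn_integral_cong) (auto simp: iff ennreal_less_iff indicator_def)
    also have "\<dots> = (\<integral>\<^sup>+ k. ennreal (2 powr real_of_int k) \<partial>count_space {..K})"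
      by (simp add: nn_integral_count_space_indicator)
    also have "\<dots> = (\<integral>\<^sup>+ n. ennreal (2 powr real_of_int (K - int n)) \<partial>count_space UNIV)"
      by (rule nn_integral_bij_count_space[OF bij, symmetric])
    also have "\<dots> = (\<Sum>n. ennreal (2 powr real_of_int (K - int n)))"
      by (rule nn_integral_count_space_nat)
    also have "\<dots> = ennreal (2 powr real_of_int K * 2)"
    proof (rule suminf_ennreal_eq)
      have "(\<lambda>n. 2 powr real_of_int K * (1 / 2) ^ n) sums (2 powr real_of_int K * (1 / (1 - 1 / 2)))"
        by (intro sums_mult geometric_sums) simp
      moreover have "2 powr real_of_int (K - int n) = 2 powr real_of_int K * (1 / 2) ^ n" for n
      proof -
        have "2 powr real_of_int (K - int n) = 2 powr real_of_int K / 2 powr real n"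
          by (simp only: of_int_diff of_int_of_nat_eq powr_diff)
        also have "2 powr real n = (2::real) ^ n" by (rule powr_realpow) simp
        finally show ?thesis by (simp add: power_one_over)
      qed
      ultimately show "(\<lambda>n. 2 powr real_of_int (K - int n)) sums (2 powr real_of_int K * 2)"
        by simp
    qed simp
    also have "\<dots> \<le> ennreal (2 * r)"
      using iff[of K] by (intro ennreal_leI) simp
    also have "\<dots> = 2 * a" using real by (simp add: ennreal_mult)
    finally show ?thesis .
  qed
qed

section \<open>The area integral\<close>

definition tent_area :: "real \<Rightarrow> ((real ^ 'n) \<times> real \<Rightarrow> complex) \<Rightarrow> real ^ 'n \<Rightarrow> ennreal" where
  "tent_area q f x =
     (\<integral>\<^sup>+ (y, t). ennreal (indicator (ball y t) x / measure gauss_measure (ball y t)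
                            * norm (f (y, t)) powr q) \<partial>tent_measure)"

lemma tent_norm_area: "tent_norm q f = (\<integral>\<^sup>+ x. epowr (tent_area q f x) (1 / q) \<partial>gauss_measure)"
  by (simp add: tent_norm_def tent_area_def)

definition area_kernel :: "real ^ 'n \<Rightarrow> (real ^ 'n) \<times> real \<Rightarrow> real" where
  "area_kernel x p = indicator (ball (fst p) (snd p)) x / measure gauss_measure (ball (fst p) (snd p))"

lemma area_kernel_nonneg: "0 \<le> area_kernel x p"
  by (simp add: area_kernel_def)

lemma tent_area_kernel:
  "tent_area q f x = (\<integral>\<^sup>+ p. ennreal (area_kernel x p * norm (f p) powr q) \<partial>tent_measure)"
  by (simp add: tent_area_def area_kernel_def split_beta')

lemma tent_area_mono:
  assumes "\<And>p. p \<in> tent_domain \<Longrightarrow> norm (f p) \<le> norm (g p)" and "0 \<le> q"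
  shows "tent_area q f x \<le> tent_area q g x"
  unfolding tent_area_kernel using assms
  by (intro nn_integral_mono ennreal_leI mult_left_mono powr_mono2 area_kernel_nonneg) auto

lemma tent_norm_mono:
  assumes "\<And>p. p \<in> tent_domain \<Longrightarrow> norm (f p) \<le> norm (g p)" and "1 < q"
  shows "tent_norm q f \<le> tent_norm q g"
  unfolding tent_norm_area using assms
  by (intro nn_integral_mono epowr_mono tent_area_mono) auto

lemma in_ball_measurable [measurable]:
  "Measurable.pred (gauss_measure \<Otimes>\<^sub>M (tent_measure :: ((real ^ 'n) \<times> real) measure))
     (\<lambda>z. fst z \<in> ball (fst (snd z)) (snd (snd z)))"
  unfolding mem_ball by measurable

text \<open>The measure of a section of the Borel set \<open>{((y, t), x). |y - x| < t \<and> x \<in> S}\<close> depends measurably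
  on \<open>(y, t)\<close>.\<close>

lemma measure_ball_measurable [measurable]:
  assumes [measurable]: "S \<in> sets borel"
  shows "(\<lambda>p :: (real ^ 'n) \<times> real. measure gauss_measure (ball (fst p) (snd p) \<inter> S)) \<in> borel_measurable tent_measure"
proof -
  define Q where "Q = {z \<in> space (tent_measure \<Otimes>\<^sub>M gauss_measure).
      snd z \<in> ball (fst (fst z)) (snd (fst z)) \<and> (snd z :: real ^ 'n) \<in> S}"
  have "Q \<in> sets (tent_measure \<Otimes>\<^sub>M gauss_measure)"
    unfolding Q_def mem_ball by measurable
  then have "(\<lambda>p. emeasure gauss_measure (Pair p -` Q)) \<in> borel_measurable tent_measure"
    by (rule gauss.measurable_emeasure_Pair)
  moreover have "Pair p -` Q = ball (fst p) (snd p) \<inter> S" if "p \<in> space tent_measure" for p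
    using that by (auto simp: Q_def space_pair_measure)
  ultimately have "(\<lambda>p. emeasure gauss_measure (ball (fst p) (snd p) \<inter> S)) \<in> borel_measurable tent_measure"
    by (subst measurable_cong[symmetric]) auto
  then show ?thesis unfolding measure_def by measurable
qed

lemma area_kernel_measurable [measurable]:
  "(\<lambda>z. area_kernel (fst z) (snd z) :: real)
   \<in> borel_measurable (gauss_measure \<Otimes>\<^sub>M (tent_measure :: ((real ^ 'n) \<times> real) measure))"
proof -
  have [measurable]: "(\<lambda>p :: (real ^ 'n) \<times> real. measure gauss_measure (ball (fst p) (snd p))) \<in> borel_measurable tent_measure"
    using measure_ball_measurable[of UNIV] by simp
  have "(\<lambda>z :: _ \<times> ((real ^ 'n) \<times> real). (if fst z \<in> ball (fst (snd z)) (snd (snd z)) then 1 else 0)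
      / measure gauss_measure (ball (fst (snd z)) (snd (snd z))) :: real)
   \<in> borel_measurable (gauss_measure \<Otimes>\<^sub>M tent_measure)" by measurable
  then show ?thesis by (simp add: indicator_def area_kernel_def)
qed

lemma area_kernel_measurable1 [measurable]:
  fixes x :: "real ^ 'n"
  shows "area_kernel x \<in> borel_measurable tent_measure"
  using measurable_compose[OF measurable_Pair1' area_kernel_measurable, of x] by simp

lemma tent_area_measurable [measurable]:
  fixes f :: "(real ^ 'n) \<times> real \<Rightarrow> complex"
  assumes [measurable]: "f \<in> borel_measurable tent_measure"
  shows "tent_area q f \<in> borel_measurable borel"
proof -
  have "(\<lambda>x. \<integral>\<^sup>+ p. ennreal (area_kernel x p * norm (f p) powr q) \<partial>tent_measure)
    \<in> borel_measurable gauss_measure"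
    by (intro tent.borel_measurable_nn_integral) (simp add: split_beta')
  then show ?thesis
    by (simp add: tent_area_kernel[abs_def])
qed

text \<open>The pointwise inequality \<open>|a + b|\<^sup>q \<le> 2\<^sup>q (|a|\<^sup>q + |b|\<^sup>q)\<close>, integrated over the cone at \<open>x\<close>.\<close>

lemma tent_area_add_le:
  fixes f :: "(real ^ 'n) \<times> real \<Rightarrow> complex"
  assumes [measurable]: "f \<in> borel_measurable tent_measure" "g \<in> borel_measurable tent_measure"
    and q: "1 < q"
  shows "tent_area q (\<lambda>p. f p + g p) x \<le> ennreal (2 powr q) * (tent_area q f x + tent_area q g x)"
proof -
  have *: "norm (a + b) powr q \<le> 2 powr q * (norm a powr q + norm b powr q)" for a b :: complex
  proof -
    have "norm (a + b) \<le> 2 * max (norm a) (norm b)"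
      using norm_triangle_ineq[of a b] by linarith
    then have "norm (a + b) powr q \<le> (2 * max (norm a) (norm b)) powr q"
      using q by (intro powr_mono2) auto
    also have "\<dots> = 2 powr q * max (norm a) (norm b) powr q"
      by (rule powr_mult)
    also have "max (norm a) (norm b) powr q \<le> norm a powr q + norm b powr q"
      by (auto simp: max_def)
    finally show ?thesis by simp
  qed
  have "tent_area q (\<lambda>p. f p + g p) x \<le> (\<integral>\<^sup>+ p. ennreal (2 powr q) *
      (ennreal (area_kernel x p * norm (f p) powr q) + ennreal (area_kernel x p * norm (g p) powr q)) \<partial>tent_measure)"
    unfolding tent_area_kernel
  proof (intro nn_integral_mono)
    fix p
    have "ennreal (area_kernel x p * norm (f p + g p) powr q) \<le> ennreal (area_kernel x p * (2 powr q * (norm (f p) powr q + norm (g p) powr q)))"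
      by (intro ennreal_leI mult_left_mono * area_kernel_nonneg)
    also have "\<dots> = ennreal (2 powr q * (area_kernel x p * norm (f p) powr q + area_kernel x p * norm (g p) powr q))"
      by (simp add: algebra_simps)
    also have "\<dots> = ennreal (2 powr q) * (ennreal (area_kernel x p * norm (f p) powr q) + ennreal (area_kernel x p * norm (g p) powr q))"
      by (subst ennreal_mult) (simp_all add: area_kernel_nonneg ennreal_plus)
    finally show "ennreal (area_kernel x p * norm (f p + g p) powr q) \<le> \<dots>" .
  qed
  also have "\<dots> = ennreal (2 powr q) * (tent_area q f x + tent_area q g x)"
    unfolding tent_area_kernel
    by (simp add: nn_integral_cmult nn_integral_add)
  finally show ?thesis .
qed

lemma tent_norm_add_le:
  fixes f :: "(real ^ 'n) \<times> real \<Rightarrow> complex"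
  assumes [measurable]: "f \<in> borel_measurable tent_measure" "g \<in> borel_measurable tent_measure"
    and q: "1 < q"
  shows "tent_norm q (\<lambda>p. f p + g p) \<le> 4 * (tent_norm q f + tent_norm q g)"
proof -
  have "tent_norm q (\<lambda>p. f p + g p)
     \<le> (\<integral>\<^sup>+ x. 4 * (epowr (tent_area q f x) (1 / q) + epowr (tent_area q g x) (1 / q)) \<partial>gauss_measure)"
    unfolding tent_norm_area using tent_area_add_le[OF assms]
    by (intro nn_integral_mono epowr_add_le q)
  also have "\<dots> = 4 * (tent_norm q f + tent_norm q g)"
    unfolding tent_norm_area by (simp add: nn_integral_cmult nn_integral_add)
  finally show ?thesis .
qed

text \<open>Integrating over \<open>S\<close> in \<open>x\<close> first, the kernel turns into the proportion of the ball \<open>B(y,t)\<close>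
  that is covered by \<open>S\<close>. For \<open>S = UNIV\<close> this proportion is \<open>1\<close>, and the whole
  \<open>L\<^sup>q\<close> norm of \<open>f\<close> is recovered.\<close>

lemma tent_area_Fubini:
  fixes f :: "(real ^ 'n) \<times> real \<Rightarrow> complex"
  assumes [measurable]: "f \<in> borel_measurable tent_measure" "S \<in> sets borel"
  shows "(\<integral>\<^sup>+ x. tent_area q f x * indicator S x \<partial>gauss_measure)
    = (\<integral>\<^sup>+ p. ennreal (measure gauss_measure (ball (fst p) (snd p) \<inter> S) / measure gauss_measure (ball (fst p) (snd p))
        * norm (f p) powr q) \<partial>tent_measure)"
proof -
  have "(\<integral>\<^sup>+ x. tent_area q f x * indicator S x \<partial>gauss_measure)
      = (\<integral>\<^sup>+ x. (\<integral>\<^sup>+ p. ennreal (area_kernel x p * norm (f p) powr q) * indicator S x \<partial>tent_measure) \<partial>gauss_measure)"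
    unfolding tent_area_kernel
    by (intro nn_integral_cong, subst nn_integral_multc) auto
  also have "\<dots> = (\<integral>\<^sup>+ p. (\<integral>\<^sup>+ x. ennreal (area_kernel x p * norm (f p) powr q) * indicator S x \<partial>gauss_measure) \<partial>tent_measure)"
    by (rule gt.Fubini'[symmetric]) (simp add: split_beta')
  also have "\<dots> = (\<integral>\<^sup>+ p. ennreal (measure gauss_measure (ball (fst p) (snd p) \<inter> S) / measure gauss_measure (ball (fst p) (snd p))
        * norm (f p) powr q) \<partial>tent_measure)"
  proof (intro nn_integral_cong)
    fix p :: "(real ^ 'n) \<times> real"
    let ?B = "ball (fst p) (snd p)"
    let ?c = "norm (f p) powr q / measure gauss_measure ?B"
    have "(\<integral>\<^sup>+ x. ennreal (area_kernel x p * norm (f p) powr q) * indicator S x \<partial>gauss_measure)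
       = (\<integral>\<^sup>+ x. ennreal ?c * indicator (?B \<inter> S) x \<partial>gauss_measure)"
      by (intro nn_integral_cong) (auto simp: area_kernel_def split: split_indicator)
    also have "\<dots> = ennreal ?c * emeasure gauss_measure (?B \<inter> S)"
      by (intro nn_integral_cmult_indicator) simp
    also have "\<dots> = ennreal (measure gauss_measure (?B \<inter> S) / measure gauss_measure ?B * norm (f p) powr q)"
      by (simp add: gauss.emeasure_eq_measure mult.commute flip: ennreal_mult)
    finally show "(\<integral>\<^sup>+ x. ennreal (area_kernel x p * norm (f p) powr q) * indicator S x \<partial>gauss_measure) = \<dots>" .
  qed
  finally show ?thesis .
qed

text \<open>Smallness in \<open>L\<^sup>q\<close> implies smallness in the tent space.\<close>

lemma tent_norm_le_integral:
  fixes f :: "(real ^ 'n) \<times> real \<Rightarrow> complex"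
  assumes [measurable]: "f \<in> borel_measurable tent_measure"
    and q: "1 < q" and \<epsilon>: "0 < \<epsilon>"
  shows "tent_norm q f \<le> ennreal \<epsilon> + ennreal (\<epsilon> powr (1 - q)) * (\<integral>\<^sup>+ p. ennreal (norm (f p) powr q) \<partial>tent_measure)"
proof -
  have "tent_norm q f \<le> (\<integral>\<^sup>+ x. ennreal \<epsilon> + ennreal (\<epsilon> powr (1 - q)) * tent_area q f x \<partial>gauss_measure)"
    unfolding tent_norm_area by (intro nn_integral_mono epowr_root_le q \<epsilon>)
  also have "\<dots> = ennreal \<epsilon> + ennreal (\<epsilon> powr (1 - q)) * (\<integral>\<^sup>+ x. tent_area q f x \<partial>gauss_measure)"
    by (simp add: nn_integral_add nn_integral_cmult emeasure_gauss_UNIV)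
  also have "\<dots> \<le> ennreal \<epsilon> + ennreal (\<epsilon> powr (1 - q)) * (\<integral>\<^sup>+ p. ennreal (norm (f p) powr q) \<partial>tent_measure)"
  proof (intro add_left_mono mult_left_mono)
    show "(\<integral>\<^sup>+ x. tent_area q f x \<partial>gauss_measure) \<le> (\<integral>\<^sup>+ p. ennreal (norm (f p) powr q) \<partial>tent_measure)"
      using tent_area_Fubini[of f UNIV q]
      by (auto intro!: nn_integral_mono ennreal_leI mult_left_le_one_le)
  qed auto
  finally show ?thesis .
qed

section \<open>Restricting elements of the tent space to Borel sets\<close>

lemma Cc_tent_bounded:
  assumes "g \<in> Cc_tent"
  obtains K M where "compact K" "K \<subseteq> tent_domain" "0 \<le> M"
    "\<And>p. p \<in> tent_domain \<Longrightarrow> norm (g p) \<le> M * indicator K p"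
proof -
  from assms obtain K where K: "compact K" "K \<subseteq> tent_domain" "\<And>p. p \<in> tent_domain - K \<Longrightarrow> g p = 0"
    and c: "continuous_on tent_domain g"
    by (auto simp: Cc_tent_def)
  have "compact (g ` K)" using K c by (intro compact_continuous_image) (auto intro: continuous_on_subset)
  then obtain M where M: "\<And>p. p \<in> K \<Longrightarrow> norm (g p) \<le> M"
    using compact_imp_bounded[of "g ` K"] by (auto simp: bounded_iff)
  show ?thesis
  proof (rule that[of K "max M 0"])
    fix p assume "p \<in> (tent_domain :: ((real ^ 'a) \<times> real) set)"
    then show "norm (g p) \<le> max M 0 * indicator K p"
      using K(3)[of p] M[of p] by (cases "p \<in> K") auto
  qed (use K in auto)
qed

lemma Cc_tent_measurable: "g \<in> Cc_tent \<Longrightarrow> g \<in> borel_measurable tent_measure"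
  unfolding borel_measurable_tent
  by (rule borel_measurable_continuous_on_restrict) (simp add: Cc_tent_def)

lemma Cc_tent_norm_finite:
  assumes g: "g \<in> Cc_tent" and q: "1 < q"
  shows "tent_norm q g < \<infinity>"
proof -
  obtain K M where K: "compact K" "K \<subseteq> tent_domain" and M: "0 \<le> M"
    "\<And>p. p \<in> tent_domain \<Longrightarrow> norm (g p) \<le> M * indicator K p" by (rule Cc_tent_bounded[OF g]) (rule that)
  have [measurable]: "K \<in> sets tent_measure"
    using tent_sets_Int[of K] K by (simp add: Int_absorb1 compact_imp_closed)
  have "(\<integral>\<^sup>+ p. ennreal (norm (g p) powr q) \<partial>tent_measure) \<le> (\<integral>\<^sup>+ p. ennreal (M powr q) * indicator K p \<partial>tent_measure)"
  proof (intro nn_integral_mono)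
    fix p assume "p \<in> space (tent_measure :: ((real ^ 'a) \<times> real) measure)"
    then have "norm (g p) \<le> M * indicator K p" by (simp add: M)
    then show "ennreal (norm (g p) powr q) \<le> ennreal (M powr q) * indicator K p"
      using q by (cases "p \<in> K") (auto intro!: ennreal_leI powr_mono2)
  qed
  also have "\<dots> = ennreal (M powr q) * emeasure tent_measure K"
    by (rule nn_integral_cmult_indicator) simp
  also have "\<dots> < \<infinity>"
    using tent_compact_finite[OF K] by (simp add: ennreal_mult_less_top)
  finally show ?thesis
    using tent_norm_le_integral[OF Cc_tent_measurable[OF g] q, of 1]
    by (auto simp: less_top[symmetric] top_unique)
qed

lemma tent_space_measurable: "f \<in> tent_space q \<Longrightarrow> f \<in> borel_measurable tent_measure"
  by (simp add: tent_space_def borel_measurable_tent)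

lemma tent_norm_finite:
  assumes f: "f \<in> tent_space q" and q: "1 < q"
  shows "tent_norm q f < \<infinity>"
proof -
  from f obtain g where g: "\<And>k::nat. g k \<in> Cc_tent"
    and lim: "(\<lambda>k. tent_norm q (\<lambda>p. f p - g k p)) \<longlonglongrightarrow> 0"
    by (auto simp: tent_space_def)
  have "eventually (\<lambda>k. tent_norm q (\<lambda>p. f p - g k p) < 1) sequentially"
    using lim by (rule order_tendstoD) simp
  then obtain k where k: "tent_norm q (\<lambda>p. f p - g k p) < 1"
    by (auto simp: eventually_sequentially)
  note [measurable] = tent_space_measurable[OF f] Cc_tent_measurable[OF g]
  have "tent_norm q (\<lambda>p. (f p - g k p) + g k p) \<le> 4 * (tent_norm q (\<lambda>p. f p - g k p) + tent_norm q (g k))"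
    by (intro tent_norm_add_le q) measurable
  also have "\<dots> < \<infinity>"
    using k Cc_tent_norm_finite[OF g q, of k] by (auto simp: ennreal_mult_less_top intro: less_trans)
  finally show ?thesis by simp
qed

text \<open>Inner regularity, stated so that the exceptional set is small; by passing to
  complements it serves on both sides of a Borel set.\<close>

lemma inner_regular_approx:
  fixes N :: "('a :: {second_countable_topology, complete_space}) measure"
  assumes N: "sets N = sets borel" "emeasure N (space N) < \<infinity>" and B: "B \<in> sets borel" and e: "0 < e"
  obtains C where "C \<subseteq> B" "compact C" "emeasure N (B - C) \<le> ennreal e"
proof -
  interpret finite_measure N using N by (intro finite_measureI) auto
  have "\<exists>C. C \<subseteq> B \<and> compact C \<and> measure N B - e \<le> measure N C"
  proof (cases "measure N B = 0")
    case True
    then show ?thesis using e by (intro exI[of _ "{}"]) auto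
  next
    case False
    then have "0 < measure N B" by (simp add: zero_less_measure_iff)
    then have "ennreal (measure N B - e) < emeasure N B"
      using e by (simp add: emeasure_eq_measure ennreal_lessI)
    also have "\<dots> = (SUP K \<in> {K. K \<subseteq> B \<and> compact K}. emeasure N K)"
      by (rule inner_regular) (use N B in auto)
    finally obtain C where C: "C \<subseteq> B" "compact C" "ennreal (measure N B - e) < emeasure N C"
      by (auto simp: less_SUP_iff)
    then have "measure N B - e \<le> measure N C"
      by (metis emeasure_eq_measure ennreal_le_iff less_imp_le measure_nonneg)
    with C show ?thesis by blast
  qed
  then obtain C where C: "C \<subseteq> B" "compact C" "measure N B - e \<le> measure N C" by blast
  have "measure N (B - C) = measure N B - measure N C"
    using C B N by (intro finite_measure_Diff) (auto simp: compact_imp_closed)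
  with C have "measure N (B - C) \<le> e" by simp
  with C show ?thesis by (intro that) (auto simp: emeasure_eq_measure ennreal_leI)
qed

text \<open>A sharp cut-off of a compactly supported continuous function is an \<open>L\<^sup>q\<close> limit of continuous
  ones. On the support of \<open>g\<close> the measure is finite, so up to a small set the Borel set \<open>P\<close> and its
  complement are exhausted by two disjoint compact sets, and a Urysohn function
  separating these replaces the indicator of \<open>P\<close>. The error is at most \<open>|g|\<close> on the small set.\<close>

lemma Cc_tent_cutoff:
  fixes g :: "(real ^ 'n) \<times> real \<Rightarrow> complex"
  assumes g: "g \<in> Cc_tent" and P: "P \<in> sets borel" and q: "1 < q" and \<delta>: "0 < \<delta>"
  obtains \<phi> where "\<phi> \<in> Cc_tent"
    "(\<integral>\<^sup>+ p. ennreal (norm ((if p \<in> P then g p else 0) - \<phi> p) powr q) \<partial>tent_measure) \<le> ennreal \<delta>"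
proof -
  obtain K M where K: "compact K" "K \<subseteq> tent_domain" and M: "0 \<le> M"
    "\<And>p. p \<in> tent_domain \<Longrightarrow> norm (g p) \<le> M * indicator K p" by (rule Cc_tent_bounded[OF g]) (rule that)
  have Kb [measurable]: "K \<in> sets borel" using K by (simp add: compact_imp_closed)
  define N where "N = density tent_base (indicator K)"
  have N: "sets N = sets borel" by (simp add: N_def)
  have NA: "emeasure N A = emeasure tent_measure (K \<inter> A)" if A: "A \<in> sets borel" for A
  proof -
    have "emeasure N A = (\<integral>\<^sup>+ p. indicator (K \<inter> A) p \<partial>tent_base)"
      using A Kb by (simp add: N_def emeasure_density indicator_inter_arith)
    also have "\<dots> = emeasure tent_base (K \<inter> A)" using A Kb by simp
    also have "\<dots> = emeasure tent_measure (K \<inter> A)"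
      unfolding tent_measure_eq using K by (intro emeasure_restrict_space[symmetric]) auto
    finally show ?thesis .
  qed
  have fin: "emeasure N (space N) < \<infinity>"
    using NA[of UNIV] tent_compact_finite[OF K] by (simp add: N_def)
  \<comment> \<open>The final error is at most \<open>M powr q * (2 * e)\<close>; the summand \<open>1\<close> covers \<open>M = 0\<close>.\<close>
  define e where "e = \<delta> / (2 * (M powr q + 1))"
  have Mq: "0 \<le> M powr q" by simp
  have e: "0 < e" using \<delta> Mq by (simp add: e_def add_nonneg_pos)
  obtain C where C: "C \<subseteq> P" "compact C" "emeasure N (P - C) \<le> ennreal e"
    using inner_regular_approx[OF N fin P e] .
  have "- P \<in> sets borel" using P by auto
  then obtain C' where C': "C' \<subseteq> - P" "compact C'" "emeasure N (- P - C') \<le> ennreal e"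
    using inner_regular_approx[OF N fin _ e] by blast
  obtain \<psi> :: "(real ^ 'n) \<times> real \<Rightarrow> real" where \<psi>: "continuous_on UNIV \<psi>"
    "\<And>p. \<psi> p \<in> closed_segment 1 0" "\<And>p. p \<in> C \<Longrightarrow> \<psi> p = 1" "\<And>p. p \<in> C' \<Longrightarrow> \<psi> p = 0"
    using Urysohn[of C C' "1::real" 0] C C' by (auto simp: compact_imp_closed)
  define \<phi> where "\<phi> p = g p * of_real (\<psi> p)" for p
  define Z where "Z = K \<inter> ((P - C) \<union> (- P - C'))"
  have Zb: "Z \<in> sets borel" using P Kb C C' by (auto simp: Z_def compact_imp_closed)
  have [measurable]: "Z \<in> sets tent_measure"
    using tent_sets_Int[OF Zb] K by (simp add: Z_def Int_absorb1 Int_assoc[symmetric])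
  show ?thesis
  proof (rule that[of \<phi>])
    show "\<phi> \<in> Cc_tent"
      unfolding Cc_tent_def \<phi>_def mem_Collect_eq
    proof (intro conjI exI[of _ K] ballI K)
      show "continuous_on tent_domain (\<lambda>p. g p * of_real (\<psi> p))"
        using g \<psi>(1) by (intro continuous_intros) (auto simp: Cc_tent_def intro: continuous_on_subset)
      show "g p * of_real (\<psi> p) = 0" if "p \<in> tent_domain - K" for p
        using M(2)[of p] that by simp
    qed
    have pw: "ennreal (norm ((if p \<in> P then g p else 0) - \<phi> p) powr q) \<le> ennreal (M powr q) * indicator Z p"
      if p: "p \<in> tent_domain" for p
    proof (cases "p \<in> Z")
      case True
      then have gM: "norm (g p) \<le> M" using M(2)[OF p] by (simp add: Z_def)
      have "\<bar>(if p \<in> P then 1 else 0) - \<psi> p\<bar> \<le> 1"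
        using \<psi>(2)[of p] by (auto simp: closed_segment_eq_real_ivl)
      moreover have "(if p \<in> P then g p else 0) - \<phi> p = g p * of_real ((if p \<in> P then 1 else 0) - \<psi> p)"
        by (simp add: \<phi>_def algebra_simps)
      ultimately have "norm ((if p \<in> P then g p else 0) - \<phi> p) \<le> M * 1"
        using gM M(1) by (simp only: norm_mult norm_of_real) (intro mult_mono; simp)
      then show ?thesis using True q by (auto intro!: ennreal_leI powr_mono2)
    next
      case False
      then have "(if p \<in> P then g p else 0) - \<phi> p = 0"
        using M(2)[OF p] \<psi>(3,4)[of p] C(1) C'(1) by (cases "p \<in> K") (auto simp: Z_def \<phi>_def)
      then show ?thesis by simp
    qed
    have "(\<integral>\<^sup>+ p. ennreal (norm ((if p \<in> P then g p else 0) - \<phi> p) powr q) \<partial>tent_measure)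
       \<le> (\<integral>\<^sup>+ p. ennreal (M powr q) * indicator Z p \<partial>tent_measure)"
      by (intro nn_integral_mono pw) simp
    also have "\<dots> = ennreal (M powr q) * emeasure tent_measure Z"
      by (rule nn_integral_cmult_indicator) simp
    also have "emeasure tent_measure Z = emeasure N ((P - C) \<union> (- P - C'))"
      unfolding Z_def using P C C' by (intro NA[symmetric]) (auto simp: compact_imp_closed)
    also have "\<dots> \<le> emeasure N (P - C) + emeasure N (- P - C')"
      using P C C' N by (intro emeasure_subadditive) (auto simp: compact_imp_closed)
    also have "\<dots> \<le> ennreal e + ennreal e" by (intro add_mono C C')
    also have "ennreal (M powr q) * (ennreal e + ennreal e) = ennreal (M powr q * (2 * e))"
      using e by (simp add: ennreal_mult ennreal_plus[symmetric] del: ennreal_plus)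
    also have "M powr q * (2 * e) \<le> \<delta>"
    proof -
      have "M powr q * (2 * e) \<le> (M powr q + 1) * (2 * e)" using e by simp
      also have "\<dots> = \<delta>"
      proof -
        have "a * (2 * (\<delta> / (2 * a))) = \<delta>" if "a \<noteq> 0" for a :: real using that by simp
        from this[of "M powr q + 1"] show ?thesis unfolding e_def using Mq by linarith
      qed
      finally show ?thesis .
    qed
    finally show "(\<integral>\<^sup>+ p. ennreal (norm ((if p \<in> P then g p else 0) - \<phi> p) powr q) \<partial>tent_measure) \<le> ennreal \<delta>"
      by (simp add: mult_left_mono ennreal_leI)
  qed
qed

text \<open>The tent space is stable under restriction to Borel sets, so that the pieces of \<open>f\<close>
  belong to it. If \<open>g k\<close> approximates \<open>f\<close>, the restriction of \<open>g k\<close> approximates that of \<open>f\<close>,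
  and the former is itself approximated by elements of \<open>C\<^sub>c(D)\<close>.\<close>

lemma tent_space_restrict:
  fixes f :: "(real ^ 'n) \<times> real \<Rightarrow> complex"
  assumes f: "f \<in> tent_space q" and P: "P \<in> sets borel" and q: "1 < q"
  shows "(\<lambda>p. if p \<in> P then f p else 0) \<in> tent_space q"
proof -
  from f obtain g where g: "\<And>k::nat. g k \<in> Cc_tent"
    and lim: "(\<lambda>k. tent_norm q (\<lambda>p. f p - g k p)) \<longlonglongrightarrow> 0"
    by (auto simp: tent_space_def)
  note [measurable] = tent_space_measurable[OF f] Cc_tent_measurable[OF g]
  have [measurable]: "Measurable.pred tent_measure (\<lambda>p. p \<in> P)"
    using measurable_compose[OF id_measurable_tent, of "\<lambda>p. p \<in> P" "count_space UNIV"] P by simp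
  define \<epsilon> :: "nat \<Rightarrow> real" where "\<epsilon> k = 1 / real (Suc k)" for k
  have \<epsilon>: "0 < \<epsilon> k" for k by (simp add: \<epsilon>_def)
  have "\<exists>\<phi>. \<phi> \<in> Cc_tent \<and> tent_norm q (\<lambda>p. (if p \<in> P then g k p else 0) - \<phi> p) \<le> ennreal (2 * \<epsilon> k)" for k
  proof -
    \<comment> \<open>With \<open>L\<^sup>q\<close> error \<open>\<epsilon> powr q\<close> both terms of \<open>tent_norm_le_integral\<close> equal \<open>\<epsilon>\<close>.\<close>
    have "0 < \<epsilon> k powr q" using \<epsilon>[of k] by simp
    from Cc_tent_cutoff[OF g[of k] P q this] obtain \<phi> where \<phi>: "\<phi> \<in> Cc_tent"
      "(\<integral>\<^sup>+ p. ennreal (norm ((if p \<in> P then g k p else 0) - \<phi> p) powr q) \<partial>tent_measure) \<le> ennreal (\<epsilon> k powr q)" .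
    note [measurable] = Cc_tent_measurable[OF \<phi>(1)]
    have "tent_norm q (\<lambda>p. (if p \<in> P then g k p else 0) - \<phi> p) \<le> ennreal (\<epsilon> k) + ennreal (\<epsilon> k powr (1 - q)) *
       (\<integral>\<^sup>+ p. ennreal (norm ((if p \<in> P then g k p else 0) - \<phi> p) powr q) \<partial>tent_measure)"
      by (intro tent_norm_le_integral q \<epsilon>) measurable
    also have "\<dots> \<le> ennreal (\<epsilon> k) + ennreal (\<epsilon> k powr (1 - q)) * ennreal (\<epsilon> k powr q)"
      by (intro add_left_mono mult_left_mono \<phi>) simp
    also have "\<dots> = ennreal (2 * \<epsilon> k)"
      using \<epsilon>[of k] by (simp add: ennreal_mult[symmetric] powr_add[symmetric] ennreal_plus[symmetric] del: ennreal_plus)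
    finally show ?thesis using \<phi> by blast
  qed
  then have "\<forall>k. \<exists>\<phi>. \<phi> \<in> Cc_tent \<and> tent_norm q (\<lambda>p. (if p \<in> P then g k p else 0) - \<phi> p) \<le> ennreal (2 * \<epsilon> k)"
    by (rule allI)
  from choice[OF this] obtain \<phi> where "\<forall>k. \<phi> k \<in> Cc_tent \<and>
    tent_norm q (\<lambda>p. (if p \<in> P then g k p else 0) - \<phi> k p) \<le> ennreal (2 * \<epsilon> k)" ..
  then have \<phi>: "\<And>k. \<phi> k \<in> Cc_tent"
    "\<And>k. tent_norm q (\<lambda>p. (if p \<in> P then g k p else 0) - \<phi> k p) \<le> ennreal (2 * \<epsilon> k)"
    by simp_all
  note [measurable] = Cc_tent_measurable[OF \<phi>(1)]
  have le: "tent_norm q (\<lambda>p. (if p \<in> P then f p else 0) - \<phi> k p)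
     \<le> 4 * (tent_norm q (\<lambda>p. f p - g k p) + ennreal (2 * \<epsilon> k))" for k
  proof -
    have "tent_norm q (\<lambda>p. (if p \<in> P then f p else 0) - \<phi> k p)
       = tent_norm q (\<lambda>p. (if p \<in> P then f p - g k p else 0) + ((if p \<in> P then g k p else 0) - \<phi> k p))"
      by (rule arg_cong[where f = "tent_norm q"]) auto
    also have "\<dots> \<le> 4 * (tent_norm q (\<lambda>p. if p \<in> P then f p - g k p else 0)
        + tent_norm q (\<lambda>p. (if p \<in> P then g k p else 0) - \<phi> k p))"
      by (intro tent_norm_add_le q) measurable
    also have "\<dots> \<le> 4 * (tent_norm q (\<lambda>p. f p - g k p) + ennreal (2 * \<epsilon> k))"
      using q by (intro mult_left_mono add_mono \<phi> tent_norm_mono) auto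
    finally show ?thesis .
  qed
  have "(\<lambda>k. 2 * \<epsilon> k) \<longlonglongrightarrow> 2 * 0"
    unfolding \<epsilon>_def by (intro tendsto_mult tendsto_const LIMSEQ_Suc[OF lim_1_over_n])
  then have "(\<lambda>k. ennreal (2 * \<epsilon> k)) \<longlonglongrightarrow> ennreal 0"
    by (intro tendsto_ennrealI) simp
  then have lim0: "(\<lambda>k. 4 * (tent_norm q (\<lambda>p. f p - g k p) + ennreal (2 * \<epsilon> k))) \<longlonglongrightarrow> 4 * (0 + ennreal 0)"
    by (intro ennreal_tendsto_cmult tendsto_add lim) auto
  have "(\<lambda>k. tent_norm q (\<lambda>p. (if p \<in> P then f p else 0) - \<phi> k p)) \<longlonglongrightarrow> 0"
  proof (rule tendsto_sandwich[where f = "\<lambda>_. 0"])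
    show "(\<lambda>k. 4 * (tent_norm q (\<lambda>p. f p - g k p) + ennreal (2 * \<epsilon> k))) \<longlonglongrightarrow> 0"
      using lim0 by simp
    show "\<forall>\<^sub>F k in sequentially. tent_norm q (\<lambda>p. (if p \<in> P then f p else 0) - \<phi> k p)
       \<le> 4 * (tent_norm q (\<lambda>p. f p - g k p) + ennreal (2 * \<epsilon> k))"
      by (rule always_eventually) (rule allI, rule le)
    show "\<forall>\<^sub>F k in sequentially. 0 \<le> tent_norm q (\<lambda>p. (if p \<in> P then f p else 0) - \<phi> k p)"
      by simp
  qed (rule tendsto_const)
  moreover have "(\<lambda>p. if p \<in> P then f p else 0) \<in> borel_measurable tent_measure" by measurable
  ultimately show ?thesis
    unfolding tent_space_def borel_measurable_tent using \<phi>(1) by blast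
qed

section \<open>Tiles\<close>

text \<open>The generation of the dyadic cubes used at height \<open>t\<close>: for \<open>0 < t \<le> 1\<close> it is the \<open>g\<close> with
  \<open>2 ^ N / 2 ^ (g + 1) < t \<le> 2 ^ N / 2 ^ g\<close>, so the cubes have side about \<open>t / 2 ^ N\<close>.\<close>

definition gen :: "nat \<Rightarrow> real \<Rightarrow> nat" where
  "gen N t = (LEAST g. 2 ^ N < t * 2 ^ Suc g)"

lemma gen_measurable [measurable]: "gen N \<in> measurable borel (count_space UNIV)"
  unfolding gen_def by measurable

lemma gen_bounds:
  assumes "0 < t" "t \<le> 1"
  shows "2 ^ N < t * 2 ^ Suc (gen N t)" and "t * 2 ^ gen N t \<le> 2 ^ N"
proof -
  obtain n where "2 ^ N / t < 2 ^ n" using real_arch_pow[of 2 "2 ^ N / t"] by auto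
  then have "2 ^ N < t * 2 ^ n" using assms by (simp add: field_simps)
  also have "t * 2 ^ n \<le> t * 2 ^ Suc n" using assms by simp
  finally show "2 ^ N < t * 2 ^ Suc (gen N t)"
    unfolding gen_def by (rule LeastI)
  show "t * 2 ^ gen N t \<le> 2 ^ N"
  proof (cases "gen N t")
    case 0
    have "t \<le> 1" by fact
    also have "(1::real) \<le> 2 ^ N" by simp
    finally show ?thesis using 0 by simp
  next
    case (Suc g)
    then have "g < (LEAST g. 2 ^ N < t * 2 ^ Suc g)" by (simp add: gen_def)
    from not_less_Least[OF this] show ?thesis using Suc by simp
  qed
qed

definition tile :: "nat \<Rightarrow> (real ^ 'n) \<times> real \<Rightarrow> nat \<times> (int ^ 'n)" where
  "tile N p = (gen N (snd p), cell (gen N (snd p)) (fst p))"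

text \<open>There are only countably many tiles, so an arbitrary family \<open>X\<close> of cubes is allowed.\<close>

lemma tile_measurable: "{p. tile N p \<in> X} \<in> sets (borel :: ((real ^ 'n) \<times> real) measure)"
proof -
  have 1: "{p. tile N p = (g, v)} \<in> sets (borel :: ((real ^ 'n) \<times> real) measure)" for g and v :: "int ^ 'n"
  proof -
    have "{p. tile N p = (g, v)} = {p \<in> space (borel :: ((real ^ 'n) \<times> real) measure). gen N (snd p) = g \<and> cell g (fst p) = v}"
      by (auto simp: tile_def)
    also have "\<dots> \<in> sets borel" by measurable
    finally show ?thesis .
  qed
  have "{p. tile N p \<in> X} = (\<Union>(g, v)\<in>X. {p :: (real ^ 'n) \<times> real. tile N p = (g, v)})" by auto
  also have "\<dots> \<in> sets borel"
    using 1 by (intro sets.countable_UN'') auto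
  finally show ?thesis .
qed

text \<open>The bound on \<open>N\<close> says how fine the tiles are. Since the tile of \<open>(y, t)\<close> has side less than
  \<open>2 t / 2 ^ N\<close>, its diameter is at most \<open>t / 2\<close>, so that it stays inside \<open>ball y t\<close>, and at most
  \<open>(\<alpha> - 1) t / 2\<close>, so that it can be absorbed when \<open>m\<close> is enlarged to \<open>\<alpha> m\<close>. The argument \<open>dim\<close> fixes
  the dimension.\<close>

locale tent_tiles =
  fixes \<alpha> :: real and N :: nat and dim :: "'n::finite itself"
  assumes \<alpha>: "1 < \<alpha>"
    and N: "4 * real CARD('n) / 2 ^ N \<le> min 1 (\<alpha> - 1)"
begin

text \<open>The doubling constant for balls of radius at most \<open>\<alpha> m\<close> and at most
  \<open>2 ^ N + CARD('n)\<close> times the side of a cube. These bounds hold for the balls \<open>B(y,t)\<close> as well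
  as for the balls that support the atoms.\<close>

definition ball_const :: real where
  "ball_const = exp (\<alpha> * (2 + \<alpha>)) * (2 * (2 ^ N + real CARD('n))) ^ CARD('n)"

abbreviation cube_at :: "nat \<times> (int ^ 'n) \<Rightarrow> (real ^ 'n) set" where
  "cube_at Q \<equiv> cube (fst Q) (snd Q)"

lemma ball_const_pos: "0 < ball_const"
  by (simp add: ball_const_def add_nonneg_pos)

lemma cube_side_le:
  assumes "(y :: real ^ 'n, t) \<in> tent_domain"
  shows "real CARD('n) / 2 ^ gen N t \<le> min 1 (\<alpha> - 1) / 2 * t"
proof -
  from assms have t: "0 < t" "t \<le> 1" using adm_le_1[of y] by (auto simp: tent_domain_def)
  have "1 / 2 ^ gen N t \<le> 2 * t / 2 ^ N"
    using gen_bounds(1)[OF t, of N] by (simp add: field_simps)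
  then have "real CARD('n) * (1 / 2 ^ gen N t) \<le> real CARD('n) * (2 * t / 2 ^ N)"
    by (intro mult_left_mono) auto
  also have "\<dots> = 4 * real CARD('n) / 2 ^ N / 2 * t" by simp
  also have "\<dots> \<le> min 1 (\<alpha> - 1) / 2 * t"
    using N t by (intro mult_right_mono divide_right_mono) auto
  finally show ?thesis by simp
qed

text \<open>Replacing the ball \<open>B(y,t)\<close> by the tile of \<open>(y, t)\<close> costs only a constant factor. The positivity of the
  measure follows from that of the ball.\<close>

lemma tile_geometry:
  fixes y :: "real ^ 'n"
  assumes "(y, t) \<in> tent_domain"
  shows "cube_at (tile N (y, t)) \<subseteq> ball y t"
    and "measure gauss_measure (ball y t) \<le> ball_const * measure gauss_measure (cube_at (tile N (y, t)))"
    and "0 < measure gauss_measure (cube_at (tile N (y, t)))"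
proof -
  let ?i = "gen N t"
  from assms have t: "0 < t" "t < adm y" "t \<le> 1" using adm_le_1[of y] by (auto simp: tent_domain_def)
  have d: "real CARD('n) / 2 ^ ?i \<le> t / 2"
  proof -
    have "min 1 (\<alpha> - 1) / 2 * t \<le> 1 / 2 * t" using t by (intro mult_right_mono) auto
    then show ?thesis using cube_side_le[OF assms] by simp
  qed
  show "cube_at (tile N (y, t)) \<subseteq> ball y t"
  proof
    fix x assume "x \<in> cube_at (tile N (y, t))"
    then have "cell ?i y = cell ?i x" by (simp add: tile_def cube_def)
    then have "norm (y - x) < t" using cube_diameter[of ?i y x] d t by linarith
    then show "x \<in> ball y t" by (simp add: dist_norm)
  qed
  have "t \<le> (2 ^ N + real CARD('n)) / 2 ^ ?i"
    using gen_bounds(2)[OF t(1,3), of N] by (simp add: field_simps)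
  moreover have "t \<le> \<alpha> * adm y"
  proof -
    have "1 * adm y \<le> \<alpha> * adm y" using \<alpha> adm_pos[of y] by (intro mult_right_mono) auto
    with t show ?thesis by linarith
  qed
  ultimately show le: "measure gauss_measure (ball y t) \<le> ball_const * measure gauss_measure (cube_at (tile N (y, t)))"
    unfolding ball_const_def tile_def fst_conv snd_conv using \<alpha> d t
    by (intro ball_le_cube) linarith+
  have "0 < measure gauss_measure (ball y t)"
    using t by (intro gauss_open_pos) auto
  then have "0 < ball_const * measure gauss_measure (cube_at (tile N (y, t)))" using le by linarith
  then show "0 < measure gauss_measure (cube_at (tile N (y, t)))"
    using ball_const_pos by (simp add: zero_less_mult_iff)
qed

lemma tile_cube_pos: "Q \<in> tile N ` tent_domain \<Longrightarrow> 0 < measure gauss_measure (cube_at Q)"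
  using tile_geometry(3) by auto

text \<open>If every tile over \<open>V\<close> has at least half of its measure outside \<open>U\<close>, the same holds up to a
  constant for the balls \<open>B(y,t)\<close>: they contain the tile and are not much larger. By Fubini the
  \<open>q\<close>-th power of the \<open>L\<^sup>q\<close> norm of \<open>f\<close> on \<open>V\<close> is therefore controlled by the area integral over
  \<open>S - U\<close>, where \<open>S\<close> is any set containing the tiles. Taking for \<open>U\<close> a level set of the area
  integral makes the right-hand side explicit.\<close>

lemma tile_Carleson:
  fixes f :: "(real ^ 'n) \<times> real \<Rightarrow> complex"
  assumes [measurable]: "f \<in> borel_measurable tent_measure"
    and V: "V \<in> sets borel" "V \<subseteq> tent_domain" and S: "S \<in> sets borel" and U: "U \<in> sets borel"
    and sub: "\<And>p. p \<in> V \<Longrightarrow> cube_at (tile N p) \<subseteq> S"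
    and half: "\<And>p. p \<in> V \<Longrightarrow> measure gauss_measure (cube_at (tile N p)) \<le> 2 * measure gauss_measure (cube_at (tile N p) - U)"
  shows "(\<integral>\<^sup>+ p. ennreal (norm (f p) powr q) * indicator V p \<partial>tent_measure)
    \<le> ennreal (2 * ball_const) * (\<integral>\<^sup>+ x. tent_area q f x * indicator (S - U) x \<partial>gauss_measure)"
proof -
  have SU [measurable]: "S - U \<in> sets borel" using S U by auto
  let ?w = "\<lambda>p. measure gauss_measure (ball (fst p) (snd p) \<inter> (S - U)) / measure gauss_measure (ball (fst p) (snd p))"
  have "(\<integral>\<^sup>+ p. ennreal (norm (f p) powr q) * indicator V p \<partial>tent_measure)
     \<le> (\<integral>\<^sup>+ p. ennreal (2 * ball_const) * ennreal (?w p * norm (f p) powr q) \<partial>tent_measure)"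
  proof (intro nn_integral_mono)
    fix p assume "p \<in> space (tent_measure :: ((real ^ 'n) \<times> real) measure)"
    show "ennreal (norm (f p) powr q) * indicator V p \<le> ennreal (2 * ball_const) * ennreal (?w p * norm (f p) powr q)"
    proof (cases "p \<in> V")
      case True
      obtain y t where p: "p = (y, t)" by (cases p)
      have D: "(y, t) \<in> tent_domain" using True V p by auto
      let ?T = "cube_at (tile N p)" and ?B = "ball y t"
      have B: "0 < measure gauss_measure ?B"
        using D by (intro gauss_open_pos) (auto simp: tent_domain_def)
      have "measure gauss_measure ?B \<le> ball_const * measure gauss_measure ?T"
        using tile_geometry(2)[OF D] by (simp add: p)
      also have "\<dots> \<le> ball_const * (2 * measure gauss_measure (?T - U))"
        using half[OF True] ball_const_pos by (intro mult_left_mono) auto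
      also have "\<dots> \<le> ball_const * (2 * measure gauss_measure (?B \<inter> (S - U)))"
        using ball_const_pos sub[OF True] tile_geometry(1)[OF D] S U
        by (intro mult_left_mono gauss.finite_measure_mono) (auto simp: p)
      finally have "1 \<le> 2 * ball_const * ?w p"
        using B by (simp add: p field_simps)
      then have "1 * norm (f p) powr q \<le> 2 * ball_const * ?w p * norm (f p) powr q"
        by (intro mult_right_mono) auto
      then show ?thesis
        using True ball_const_pos by (simp add: ennreal_mult[symmetric] mult.assoc ennreal_leI)
    qed simp
  qed
  also have "\<dots> = ennreal (2 * ball_const) * (\<integral>\<^sup>+ p. ennreal (?w p * norm (f p) powr q) \<partial>tent_measure)"
  proof (rule nn_integral_cmult)
    have [measurable]: "(\<lambda>p :: (real ^ 'n) \<times> real. measure gauss_measure (ball (fst p) (snd p))) \<in> borel_measurable tent_measure"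
      using measure_ball_measurable[of UNIV] by simp
    show "(\<lambda>p. ennreal (?w p * norm (f p) powr q)) \<in> borel_measurable tent_measure" by measurable
  qed
  also have "(\<integral>\<^sup>+ p. ennreal (?w p * norm (f p) powr q) \<partial>tent_measure)
      = (\<integral>\<^sup>+ x. tent_area q f x * indicator (S - U) x \<partial>gauss_measure)"
    by (rule tent_area_Fubini[symmetric]) measurable
  finally show ?thesis .
qed

text \<open>The centre is the first component \<open>y0\<close> of a point \<open>(y0, t0)\<close> of the domain whose tile is \<open>Q\<close>.
  Write \<open>s\<close> for the bound on the diameter of \<open>Q\<close>. A point \<open>(y, t)\<close> over \<open>Q\<close> whose tile is not
  coarser than \<open>Q\<close> satisfies two bounds: \<open>t\<close> is at most \<open>2 ^ N\<close> times the side of \<open>Q\<close>, which keeps the ball comparable to \<open>Q\<close>, and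
  \<open>t < m(y) \<le> (1 + s) m(y0)\<close>, which keeps its radius below \<open>\<alpha> m(y0)\<close> once \<open>s\<close> has been added. The
  radius is the minimum of the two.\<close>

lemma atom_ball_exists:
  assumes Q: "Q \<in> tile N ` tent_domain"
  shows "\<exists>B \<in> admissible_balls \<alpha>. B \<in> sets borel \<and> cube_at Q \<subseteq> B \<and>
    measure gauss_measure B \<le> ball_const * measure gauss_measure (cube_at Q) \<and>
    (\<forall>p\<in>tent_domain. fst Q \<le> gen N (snd p) \<longrightarrow> fst p \<in> cube_at Q \<longrightarrow> p \<in> tent1 B)"
proof -
  from Q obtain y0 t0 where D0: "(y0, t0) \<in> tent_domain" and Q0: "Q = tile N (y0, t0)" by auto
  define i where "i = gen N t0"
  have Qi: "fst Q = i" "snd Q = cell i y0" by (simp_all add: Q0 tile_def i_def)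
  define s where "s = real CARD('n) / 2 ^ i"
  from D0 have t0: "0 < t0" "t0 < adm y0" "t0 \<le> 1" using adm_le_1[of y0] by (auto simp: tent_domain_def)
  have s0: "0 \<le> s" by (simp add: s_def)
  have s: "s \<le> min 1 (\<alpha> - 1) / 2 * t0"
    using cube_side_le[OF D0] by (simp add: s_def i_def)
  also have "\<dots> \<le> min 1 (\<alpha> - 1) / 2 * adm y0"
    using t0 \<alpha> by (intro mult_left_mono) auto
  finally have s1: "s \<le> min 1 (\<alpha> - 1) / 2 * adm y0" .
  have "min 1 (\<alpha> - 1) / 2 * adm y0 \<le> 1 / 2 * adm y0"
    using adm_pos[of y0] by (intro mult_right_mono) auto
  with s1 adm_pos[of y0] have s2: "s < adm y0" by linarith
  have "min 1 (\<alpha> - 1) / 2 * adm y0 \<le> (\<alpha> - 1) / 2 * adm y0"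
    using adm_pos[of y0] by (intro mult_right_mono) auto
  with s1 have s3: "s \<le> (\<alpha> - 1) / 2 * adm y0" by linarith
  have "(\<alpha> - 1) / 2 * adm y0 \<le> (\<alpha> - 1) / 2 * 1"
    using adm_le_1[of y0] \<alpha> by (intro mult_left_mono) auto
  with s3 have s4: "s \<le> (\<alpha> - 1) / 2" by linarith
  define r where "r = min (\<alpha> * adm y0) ((2 ^ N + real CARD('n)) / 2 ^ i)"
  have aadm: "adm y0 \<le> \<alpha> * adm y0"
    using \<alpha> adm_pos[of y0] mult_right_mono[of 1 \<alpha> "adm y0"] by linarith
  have "s < (2 ^ N + real CARD('n)) / 2 ^ i" by (simp add: s_def divide_strict_right_mono)
  then have sr: "s < r" using s2 aadm by (simp add: r_def)
  show ?thesis
  proof (intro bexI[of _ "ball y0 r"] conjI ballI impI)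
    show "ball y0 r \<in> admissible_balls \<alpha>"
      unfolding admissible_balls_def using sr s0 by (auto simp: r_def intro!: exI[of _ y0] exI[of _ r])
    show "cube_at Q \<subseteq> ball y0 r"
    proof
      fix x assume "x \<in> cube_at Q"
      then have "cell i y0 = cell i x" by (simp add: Qi cube_def)
      from cube_diameter[OF this] sr have "norm (y0 - x) < r" by (simp add: s_def)
      then show "x \<in> ball y0 r" by (simp add: dist_norm)
    qed
    have "real CARD('n) / 2 ^ i \<le> adm y0" "0 \<le> r" "r \<le> \<alpha> * adm y0" "r \<le> (2 ^ N + real CARD('n)) / 2 ^ i"
      using s2 less_imp_le[OF le_less_trans[OF s0 sr]] by (auto simp: s_def r_def)
    then show "measure gauss_measure (ball y0 r) \<le> ball_const * measure gauss_measure (cube_at Q)"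
      unfolding ball_const_def Qi using \<alpha> by (intro ball_le_cube) linarith+
    fix p :: "(real ^ 'n) \<times> real"
    assume D: "p \<in> tent_domain" and g: "fst Q \<le> gen N (snd p)" and "fst p \<in> cube_at Q"
    obtain y t where p: "p = (y, t)" by (cases p)
    from D have t: "0 < t" "t < adm y" "t \<le> 1" using adm_le_1[of y] by (auto simp: tent_domain_def p)
    have "cell i y = cell i y0" using \<open>fst p \<in> cube_at Q\<close> by (simp add: Qi cube_def p)
    from cube_diameter[OF this] have ys: "norm (y - y0) \<le> s" by (simp add: s_def)
    have "t + s \<le> \<alpha> * adm y0"
    proof -
      have "t \<le> (1 + norm (y - y0)) * adm y0" using t adm_slow[of y y0] by simp
      also have "\<dots> \<le> (1 + (\<alpha> - 1) / 2) * adm y0"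
        using ys s4 adm_pos[of y0] by (intro mult_right_mono) auto
      finally have "t + s \<le> (1 + (\<alpha> - 1) / 2) * adm y0 + (\<alpha> - 1) / 2 * adm y0"
        using s3 by linarith
      also have "\<dots> = \<alpha> * adm y0" by (simp add: field_simps)
      finally show ?thesis .
    qed
    moreover have "t + s \<le> (2 ^ N + real CARD('n)) / 2 ^ i"
    proof -
      have "t * 2 ^ i \<le> t * 2 ^ gen N t"
        using g t by (intro mult_left_mono power_increasing) (auto simp: Qi p)
      also have "\<dots> \<le> 2 ^ N" by (rule gen_bounds(2)[OF t(1,3)])
      finally have "t \<le> 2 ^ N / 2 ^ i" by (simp add: field_simps)
      then show ?thesis by (simp add: s_def add_divide_distrib)
    qed
    ultimately have "t + s \<le> r" by (simp add: r_def)
    have "t \<le> infdist y (- ball y0 r)" if "- ball y0 r \<noteq> {}"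
      unfolding infdist_notempty[OF that]
    proof (rule cINF_greatest[OF that])
      fix z assume "z \<in> - ball y0 r"
      then have "r \<le> dist y0 z" by simp
      also have "\<dots> \<le> dist y0 y + dist y z" by (rule dist_triangle)
      finally show "t \<le> dist y z" using ys \<open>t + s \<le> r\<close> by (simp add: dist_norm norm_minus_commute)
    qed
    then show "p \<in> tent1 (ball y0 r)" using t by (auto simp: tent1_def p)
  qed auto
qed

definition atom_ball :: "nat \<times> (int ^ 'n) \<Rightarrow> (real ^ 'n) set" where
  "atom_ball Q = (SOME B. B \<in> admissible_balls \<alpha> \<and> B \<in> sets borel \<and> cube_at Q \<subseteq> B \<and>
    measure gauss_measure B \<le> ball_const * measure gauss_measure (cube_at Q) \<and>
    (\<forall>p\<in>tent_domain. fst Q \<le> gen N (snd p) \<longrightarrow> fst p \<in> cube_at Q \<longrightarrow> p \<in> tent1 B))"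

lemma atom_ball:
  assumes "Q \<in> tile N ` tent_domain"
  shows "atom_ball Q \<in> admissible_balls \<alpha>" "atom_ball Q \<in> sets borel" "cube_at Q \<subseteq> atom_ball Q"
    "measure gauss_measure (atom_ball Q) \<le> ball_const * measure gauss_measure (cube_at Q)"
    "\<And>p. p \<in> tent_domain \<Longrightarrow> fst Q \<le> gen N (snd p) \<Longrightarrow> fst p \<in> cube_at Q \<Longrightarrow> p \<in> tent1 (atom_ball Q)"
proof -
  have "\<exists>B. B \<in> admissible_balls \<alpha> \<and> B \<in> sets borel \<and> cube_at Q \<subseteq> B \<and>
    measure gauss_measure B \<le> ball_const * measure gauss_measure (cube_at Q) \<and>
    (\<forall>p\<in>tent_domain. fst Q \<le> gen N (snd p) \<longrightarrow> fst p \<in> cube_at Q \<longrightarrow> p \<in> tent1 B)"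
    using atom_ball_exists[OF assms] by (simp only: Bex_def)
  from someI_ex[OF this, folded atom_ball_def]
  show "atom_ball Q \<in> admissible_balls \<alpha>" "atom_ball Q \<in> sets borel" "cube_at Q \<subseteq> atom_ball Q"
    "measure gauss_measure (atom_ball Q) \<le> ball_const * measure gauss_measure (cube_at Q)"
    "\<And>p. p \<in> tent_domain \<Longrightarrow> fst Q \<le> gen N (snd p) \<Longrightarrow> fst p \<in> cube_at Q \<Longrightarrow> p \<in> tent1 (atom_ball Q)"
    by simp_all
qed

lemma atom_ball_pos:
  assumes Q: "Q \<in> tile N ` tent_domain"
  shows "0 < measure gauss_measure (atom_ball Q)"
    and "measure gauss_measure (cube_at Q) \<le> measure gauss_measure (atom_ball Q)"
proof -
  show 1: "measure gauss_measure (cube_at Q) \<le> measure gauss_measure (atom_ball Q)"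
    using atom_ball(2,3)[OF Q] by (intro gauss.finite_measure_mono) auto
  show "0 < measure gauss_measure (atom_ball Q)"
    using 1 tile_cube_pos[OF Q] by simp
qed

end

section \<open>Heavy cubes and the pieces they cut out\<close>

locale tent_decomposition = tent_tiles \<alpha> N "TYPE('n::finite)" for \<alpha> :: real and N :: nat +
  fixes q :: real and f :: "(real ^ 'n) \<times> real \<Rightarrow> complex"
  assumes q: "1 < q" and f: "f \<in> tent_space q"
begin

lemma f_measurable [measurable]: "f \<in> borel_measurable tent_measure"
  using f by (rule tent_space_measurable)

text \<open>The function called \<open>A\<close> in the introduction.\<close>

definition area_root :: "real ^ 'n \<Rightarrow> ennreal" where
  "area_root x = epowr (tent_area q f x) (1 / q)"

definition level :: "int \<Rightarrow> (real ^ 'n) set" where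
  "level k = {x. ennreal (2 powr k) < area_root x}"

text \<open>Only cubes that occur as tiles are admitted, because their side is small compared with \<open>m\<close>,
  as the doubling estimate demands.\<close>

definition heavy :: "int \<Rightarrow> (nat \<times> (int ^ 'n)) set" where
  "heavy k = {Q. Q \<in> tile N ` tent_domain \<and>
     measure gauss_measure (cube_at Q) < 2 * measure gauss_measure (cube_at Q \<inter> level k)}"

text \<open>The maximal heavy cubes: no cube of a coarser generation that meets, and hence contains, \<open>Q\<close> is
  heavy.\<close>

definition top_heavy :: "int \<Rightarrow> (nat \<times> (int ^ 'n)) set" where
  "top_heavy k = {Q \<in> heavy k. \<forall>j<fst Q. \<forall>y\<in>cube_at Q. (j, cell j y) \<notin> heavy k}"

text \<open>The condition \<open>i \<le> gen N (snd p)\<close> together with \<open>cell i (fst p) = v\<close> says that the tile of \<open>p\<close> is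
  contained in the cube with index \<open>(i, v)\<close>.\<close>

definition piece :: "int \<times> nat \<times> (int ^ 'n) \<Rightarrow> ((real ^ 'n) \<times> real) set" where
  "piece a = (case a of (k, i, v) \<Rightarrow> if (i, v) \<in> top_heavy k
     then {p \<in> tent_domain. tile N p \<in> heavy k - heavy (k + 1) \<and> i \<le> gen N (snd p) \<and> cell i (fst p) = v}
     else {})"

lemma area_root_measurable [measurable]: "area_root \<in> borel_measurable borel"
  unfolding area_root_def by measurable

lemma level_sets [measurable]: "level k \<in> sets borel"
proof -
  have "level k = {x \<in> space borel. ennreal (2 powr k) < area_root x}" by (simp add: level_def)
  also have "\<dots> \<in> sets borel" by measurable
  finally show ?thesis .
qed

lemma tent_norm_area_root: "tent_norm q f = (\<integral>\<^sup>+ x. area_root x \<partial>gauss_measure)"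
  by (simp add: tent_norm_area area_root_def)

lemma piece_sets [measurable]: "piece a \<in> sets borel"
proof -
  obtain k i v where a: "a = (k, i, v)" by (cases a)
  have [measurable]: "{p :: (real ^ 'n) \<times> real. tile N p \<in> X} \<in> sets borel" for X
    by (rule tile_measurable)
  have "{p \<in> tent_domain. tile N p \<in> heavy k - heavy (k + 1) \<and> i \<le> gen N (snd p) \<and> cell i (fst p) = v}
    = {p \<in> space borel. p \<in> tent_domain \<and> p \<in> {p. tile N p \<in> heavy k - heavy (k + 1)} \<and> i \<le> gen N (snd p) \<and> cell i (fst p) = v}"
    by auto
  also have "\<dots> \<in> sets borel" by measurable
  finally show ?thesis by (simp add: piece_def a)
qed

lemma piece_subset: "piece a \<subseteq> tent_domain"
  by (auto simp: piece_def split: prod.splits if_splits)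

lemma level_antimono:
  assumes "k \<le> l"
  shows "level l \<subseteq> level k"
proof
  fix x assume "x \<in> level l"
  moreover have "ennreal (2 powr k) \<le> ennreal (2 powr l)" using assms by (intro ennreal_leI powr_mono) auto
  ultimately show "x \<in> level k" unfolding level_def mem_Collect_eq by (metis le_less_trans)
qed

lemma heavy_antimono: "k \<le> l \<Longrightarrow> heavy l \<subseteq> heavy k"
proof
  fix Q assume kl: "k \<le> l" and Q: "Q \<in> heavy l"
  have "level l \<subseteq> level k" using kl by (rule level_antimono)
  then have "measure gauss_measure (cube_at Q \<inter> level l) \<le> measure gauss_measure (cube_at Q \<inter> level k)"
    by (intro gauss.finite_measure_mono) auto
  with Q show "Q \<in> heavy k" by (auto simp: heavy_def)
qed

lemma top_heavy_disjoint:
  assumes "Q \<in> top_heavy k" "Q' \<in> top_heavy k" "y \<in> cube_at Q" "y \<in> cube_at Q'"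
  shows "Q = Q'"
proof -
  have eq: "Q = (fst Q, cell (fst Q) y)" "Q' = (fst Q', cell (fst Q') y)"
    using assms(3,4) by (auto simp: cube_def prod_eq_iff)
  have "(fst Q, cell (fst Q) y) \<in> heavy k" "(fst Q', cell (fst Q') y) \<in> heavy k"
    using assms(1,2) eq by (simp_all add: top_heavy_def)
  then have "\<not> fst Q < fst Q'" "\<not> fst Q' < fst Q"
    using assms by (auto simp: top_heavy_def)
  then have "fst Q = fst Q'" by simp
  then show ?thesis using eq by simp
qed

lemma piece_disjoint:
  assumes "p \<in> piece a" "p \<in> piece b"
  shows "a = b"
proof -
  obtain k i v where a: "a = (k, i, v)" by (cases a)
  obtain l j w where b: "b = (l, j, w)" by (cases b)
  have A: "(i, v) \<in> top_heavy k" "tile N p \<in> heavy k - heavy (k + 1)" "cell i (fst p) = v"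
    and B: "(j, w) \<in> top_heavy l" "tile N p \<in> heavy l - heavy (l + 1)" "cell j (fst p) = w"
    using assms by (auto simp: piece_def a b split: if_splits)
  have "k = l"
  proof (rule ccontr)
    assume "k \<noteq> l"
    then consider "k + 1 \<le> l" | "l + 1 \<le> k" by linarith
    then show False using A(2) B(2) heavy_antimono by cases blast+
  qed
  then have "(i, v) = (j, w)"
    using A B by (intro top_heavy_disjoint[of _ k _ "fst p"]) (auto simp: cube_def)
  with \<open>k = l\<close> show ?thesis by (simp add: a b)
qed

text \<open>The maximal heavy cube is the one of least generation among the heavy cubes containing \<open>fst p\<close>;
  the tile of \<open>p\<close> itself is a candidate.\<close>

lemma piece_cover:
  assumes p: "p \<in> tent_domain" "tile N p \<in> heavy k" "tile N p \<notin> heavy (k + 1)"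
  shows "\<exists>i v. p \<in> piece (k, i, v)"
proof -
  let ?y = "fst p"
  define i where "i = (LEAST i. (i, cell i ?y) \<in> heavy k)"
  have g: "(gen N (snd p), cell (gen N (snd p)) ?y) \<in> heavy k" using p by (simp add: tile_def)
  then have i: "(i, cell i ?y) \<in> heavy k" unfolding i_def by (rule LeastI)
  have ig: "i \<le> gen N (snd p)" unfolding i_def using g by (rule Least_le)
  have "(i, cell i ?y) \<in> top_heavy k"
  proof -
    have "(j, cell j x) \<notin> heavy k" if "j < i" "x \<in> cube i (cell i ?y)" for j x
    proof -
      have "cell j x = cell j ?y" using that by (intro cell_coarsen[of j i]) (auto simp: cube_def)
      moreover have "(j, cell j ?y) \<notin> heavy k" using that(1) unfolding i_def by (rule not_less_Least)
      ultimately show ?thesis by simp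
    qed
    then show ?thesis using i by (auto simp: top_heavy_def)
  qed
  then have "p \<in> piece (k, i, cell i ?y)" using p ig by (auto simp: piece_def)
  then show ?thesis by blast
qed

lemma not_heavy_half:
  assumes "p \<in> tent_domain" "tile N p \<notin> heavy k"
  shows "measure gauss_measure (cube_at (tile N p)) \<le> 2 * measure gauss_measure (cube_at (tile N p) - level k)"
proof -
  let ?T = "cube_at (tile N p)"
  have "2 * measure gauss_measure (?T \<inter> level k) \<le> measure gauss_measure ?T"
    using assms by (auto simp: heavy_def not_less)
  moreover have "measure gauss_measure ?T = measure gauss_measure (?T \<inter> level k) + measure gauss_measure (?T - level k)"
    by (subst gauss.finite_measure_Union[symmetric]) (auto intro!: arg_cong[where f = "measure gauss_measure"])
  ultimately show ?thesis by simp
qed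

text \<open>The size estimate for the atoms: off the level set the area integral is at most
  \<open>(2 powr (k + 1)) powr q\<close>, and the tiles of the piece are subcubes of the maximal cube, each light for
  \<open>k + 1\<close>.\<close>

lemma piece_integral:
  assumes Q: "(i, v) \<in> top_heavy k"
  shows "(\<integral>\<^sup>+ p. ennreal (norm (f p) powr q) * indicator (piece (k, i, v)) p \<partial>tent_measure)
    \<le> ennreal (2 * ball_const * (2 powr real_of_int (k + 1)) powr q * measure gauss_measure (cube i v))"
proof -
  let ?b = "(2 powr real_of_int (k + 1)) powr q :: real"
  have "(\<integral>\<^sup>+ p. ennreal (norm (f p) powr q) * indicator (piece (k, i, v)) p \<partial>tent_measure)
    \<le> ennreal (2 * ball_const) * (\<integral>\<^sup>+ x. tent_area q f x * indicator (cube i v - level (k + 1)) x \<partial>gauss_measure)"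
  proof (rule tile_Carleson[OF f_measurable])
    fix p assume p: "p \<in> piece (k, i, v)"
    then have *: "tile N p \<notin> heavy (k + 1)" "i \<le> gen N (snd p)" "cell i (fst p) = v" "p \<in> tent_domain"
      using Q by (auto simp: piece_def)
    show "cube_at (tile N p) \<subseteq> cube i v"
    proof
      fix x assume "x \<in> cube_at (tile N p)"
      then have "cell (gen N (snd p)) x = cell (gen N (snd p)) (fst p)" by (simp add: tile_def cube_def)
      from cell_coarsen[OF *(2) this] *(3) show "x \<in> cube i v" by (simp add: cube_def)
    qed
    show "measure gauss_measure (cube_at (tile N p)) \<le> 2 * measure gauss_measure (cube_at (tile N p) - level (k + 1))"
      by (intro not_heavy_half *)
  qed (use piece_subset in auto)
  also have "\<dots> \<le> ennreal (2 * ball_const) * (\<integral>\<^sup>+ x. ennreal ?b * indicator (cube i v) x \<partial>gauss_measure)"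
  proof (intro mult_left_mono nn_integral_mono)
    fix x
    show "tent_area q f x * indicator (cube i v - level (k + 1)) x \<le> ennreal ?b * indicator (cube i v) x"
    proof (cases "x \<in> cube i v - level (k + 1)")
      case True
      then have "area_root x \<le> ennreal (2 powr real_of_int (k + 1))" by (auto simp: level_def not_less)
      then have "tent_area q f x \<le> ennreal ?b"
        unfolding area_root_def by (rule epowr_le_D[OF _ q]) simp
      with True show ?thesis by simp
    qed simp
  qed simp
  also have "\<dots> = ennreal (2 * ball_const) * (ennreal ?b * emeasure gauss_measure (cube i v))"
    by (subst nn_integral_cmult_indicator) auto
  also have "\<dots> = ennreal (2 * ball_const * ?b * measure gauss_measure (cube i v))"
    using ball_const_pos by (simp add: gauss.emeasure_eq_measure ennreal_mult[symmetric] mult.assoc)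
  finally show ?thesis .
qed

section \<open>The atoms\<close>

definition atom_const :: real where "atom_const = (2 * ball_const) powr (1 / q)"

text \<open>The coefficient of an atom is what the size estimate of its piece requires after normalisation by the
  measure of the supporting ball. Indices that do not belong to a maximal heavy cube have an empty
  piece and get coefficient \<open>0\<close>, so that all indices can be enumerated together.\<close>

definition weight :: "int \<times> nat \<times> (int ^ 'n) \<Rightarrow> real" where
  "weight a = (case a of (k, Q) \<Rightarrow>
     if Q \<in> top_heavy k then atom_const * 2 powr real_of_int (k + 1) * measure gauss_measure (atom_ball Q) else 0)"

definition atom :: "int \<times> nat \<times> (int ^ 'n) \<Rightarrow> (real ^ 'n) \<times> real \<Rightarrow> complex" where
  "atom a p = (if p \<in> piece a then f p / of_real (weight a) else 0)"

lemma atom_const_pos: "0 < atom_const"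
  using ball_const_pos by (simp add: atom_const_def)

lemma top_heavy_tile: "Q \<in> top_heavy k \<Longrightarrow> Q \<in> tile N ` tent_domain"
  by (simp add: top_heavy_def heavy_def)

lemma weight_nonneg: "0 \<le> weight a"
  using atom_const_pos by (auto simp: weight_def split: prod.split)

text \<open>A nonempty piece has nonzero weight, so the division in the definition of the atom is undone.\<close>

lemma weight_atom: "of_real (weight a) * atom a p = (if p \<in> piece a then f p else 0)"
proof -
  have "weight a \<noteq> 0" if "p \<in> piece a"
    using that atom_const_pos atom_ball_pos(1)[OF top_heavy_tile]
    by (fastforce simp: weight_def piece_def split: prod.splits if_splits)
  then show ?thesis by (simp add: atom_def)
qed

lemma piece_measurable [measurable]: "Measurable.pred tent_measure (\<lambda>p. p \<in> piece a)"
  using measurable_compose[OF id_measurable_tent, of "\<lambda>p. p \<in> piece a" "count_space UNIV"] by simp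

lemma atom_measurable: "atom a \<in> borel_measurable tent_measure"
  unfolding atom_def[abs_def] by measurable

lemma tent_atom_atom: "tent_atom q \<alpha> (atom a)"
proof -
  obtain k Q where a: "a = (k, Q)" by (cases a)
  obtain i v where Qiv: "Q = (i, v)" by (cases Q)
  show ?thesis
    unfolding tent_atom_def
  proof (intro conjI)
    show "atom a \<in> borel_measurable (restrict_space borel tent_domain)"
      using atom_measurable by (simp add: borel_measurable_tent)
    show "\<exists>B\<in>admissible_balls \<alpha>. (\<forall>p\<in>tent_domain. atom a p \<noteq> 0 \<longrightarrow> p \<in> tent1 B) \<and>
        epowr (\<integral>\<^sup>+ p. ennreal (norm (atom a p) powr q) \<partial>tent_measure) (1 / q)
          \<le> ennreal (measure gauss_measure B powr (- (1 / (q / (q - 1)))))"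
    \<comment> \<open>For an empty piece the atom is zero and an empty ball will do.\<close>
    proof (cases "Q \<in> top_heavy k")
      case False
      then have "atom a p = 0" for p by (simp add: atom_def piece_def a Qiv)
      moreover have "ball 0 0 \<in> (admissible_balls \<alpha> :: (real ^ 'n) set set)"
        unfolding admissible_balls_def using \<alpha> by (auto simp: adm_def intro!: exI[of _ "0 :: real ^ 'n"] exI[of _ "0::real"])
      ultimately show ?thesis by (intro bexI[of _ "ball 0 0"]) auto
    next
      case True
      note Qt = top_heavy_tile[OF True]
      define b where "b = measure gauss_measure (atom_ball Q)"
      define m where "m = 2 powr real_of_int (k + 1)"
      have b: "0 < b" using atom_ball_pos[OF Qt] by (simp add: b_def)
      have m: "0 < m" by (simp add: m_def)
      have w: "weight a = atom_const * m * b" using True by (simp add: weight_def a b_def m_def)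
      have w0: "0 < weight a" using atom_const_pos b m by (simp add: w)
      have "(\<integral>\<^sup>+ p. ennreal (norm (atom a p) powr q) \<partial>tent_measure)
         = (\<integral>\<^sup>+ p. ennreal (1 / weight a powr q) * (ennreal (norm (f p) powr q) * indicator (piece a) p) \<partial>tent_measure)"
        using w0 by (intro nn_integral_cong)
          (auto simp: atom_def norm_divide powr_divide ennreal_mult[symmetric] split: split_indicator)
      also have "\<dots> = ennreal (1 / weight a powr q) * (\<integral>\<^sup>+ p. ennreal (norm (f p) powr q) * indicator (piece a) p \<partial>tent_measure)"
        by (intro nn_integral_cmult) measurable
      also have "\<dots> \<le> ennreal (1 / weight a powr q) * ennreal (2 * ball_const * m powr q * measure gauss_measure (cube i v))"
        using piece_integral[of i v k] True by (intro mult_left_mono) (simp_all add: a Qiv m_def)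
      also have "\<dots> \<le> ennreal (1 / weight a powr q) * ennreal (2 * ball_const * m powr q * b)"
        using atom_ball_pos(2)[OF Qt] ball_const_pos by (intro mult_left_mono ennreal_leI) (simp_all add: Qiv b_def)
      also have "\<dots> = ennreal (1 / weight a powr q * (2 * ball_const * m powr q * b))"
        using ball_const_pos b by (intro ennreal_mult[symmetric]) auto
      also have "1 / weight a powr q * (2 * ball_const * m powr q * b) = (b powr (- (1 / (q / (q - 1))))) powr q"
      proof -
        have "weight a powr q = atom_const powr q * m powr q * b powr q"
          by (simp add: w powr_mult)
        also have "atom_const powr q = 2 * ball_const" using q ball_const_pos by (simp add: atom_const_def powr_powr)
        finally have "1 / weight a powr q * (2 * ball_const * m powr q * b) = b / b powr q"
          using ball_const_pos m by simp
        also have "\<dots> = b powr (1 - q)" using b by (simp add: powr_diff)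
        also have "\<dots> = (b powr (- (1 / (q / (q - 1))))) powr q"
          using q by (simp add: powr_powr)
        finally show ?thesis .
      qed
      finally have "epowr (\<integral>\<^sup>+ p. ennreal (norm (atom a p) powr q) \<partial>tent_measure) (1 / q)
          \<le> ennreal (measure gauss_measure (atom_ball Q) powr (- (1 / (q / (q - 1)))))"
        unfolding b_def by (rule epowr_inverse_le[OF _ q]) simp
      moreover have "p \<in> tent1 (atom_ball Q)" if "p \<in> tent_domain" "atom a p \<noteq> 0" for p
      proof (rule atom_ball(5)[OF Qt that(1)])
        have "p \<in> piece a" using that(2) by (auto simp: atom_def split: if_splits)
        then show "fst Q \<le> gen N (snd p)" "fst p \<in> cube_at Q"
          by (auto simp: piece_def a Qiv cube_def split: if_splits)
      qed
      ultimately show ?thesis using atom_ball(1)[OF Qt] by blast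
    qed
  qed
qed

section \<open>The sum of the coefficients\<close>

text \<open>The maximal cubes are disjoint and each lies in the level set with more than half of its measure.\<close>

lemma top_heavy_sum:
  "(\<integral>\<^sup>+ Q. ennreal (measure gauss_measure (cube_at Q)) * indicator (top_heavy k) Q \<partial>count_space UNIV)
    \<le> 2 * emeasure gauss_measure (level k)"
proof -
  have cnt: "countable (top_heavy k)" by (rule countable_subset[of _ UNIV]) auto
  have "(\<integral>\<^sup>+ Q. ennreal (measure gauss_measure (cube_at Q)) * indicator (top_heavy k) Q \<partial>count_space UNIV)
     \<le> (\<integral>\<^sup>+ Q. 2 * (emeasure gauss_measure (cube_at Q \<inter> level k) * indicator (top_heavy k) Q) \<partial>count_space UNIV)"
  proof (intro nn_integral_mono)
    fix Q
    show "ennreal (measure gauss_measure (cube_at Q)) * indicator (top_heavy k) Q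
       \<le> 2 * (emeasure gauss_measure (cube_at Q \<inter> level k) * indicator (top_heavy k) Q)"
    proof (cases "Q \<in> top_heavy k")
      case True
      then have "ennreal (measure gauss_measure (cube_at Q)) \<le> ennreal (2 * measure gauss_measure (cube_at Q \<inter> level k))"
        by (intro ennreal_leI) (simp add: top_heavy_def heavy_def)
      then show ?thesis using True by (simp add: gauss.emeasure_eq_measure ennreal_mult)
    qed simp
  qed
  also have "\<dots> = 2 * (\<integral>\<^sup>+ Q. emeasure gauss_measure (cube_at Q \<inter> level k) * indicator (top_heavy k) Q \<partial>count_space UNIV)"
    by (simp add: nn_integral_cmult)
  also have "(\<integral>\<^sup>+ Q. emeasure gauss_measure (cube_at Q \<inter> level k) * indicator (top_heavy k) Q \<partial>count_space UNIV)
     = (\<integral>\<^sup>+ Q. emeasure gauss_measure (cube_at Q \<inter> level k) \<partial>count_space (top_heavy k))"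
    by (simp add: nn_integral_count_space_indicator)
  also have "\<dots> = emeasure gauss_measure (\<Union>Q\<in>top_heavy k. cube_at Q \<inter> level k)"
  proof (rule emeasure_UN_countable[symmetric, OF _ cnt])
    show "disjoint_family_on (\<lambda>Q. cube_at Q \<inter> level k) (top_heavy k)"
      using top_heavy_disjoint by (fastforce simp: disjoint_family_on_def)
  qed auto
  also have "\<dots> \<le> emeasure gauss_measure (level k)"
    by (intro emeasure_mono) auto
  finally show ?thesis by (simp add: mult_left_mono)
qed

text \<open>By doubling the weights are bounded by multiples of \<open>2 powr k\<close> times the measure of the maximal
  cubes. Summing over the cubes leaves \<open>2 powr k\<close> times the measure of the \<open>k\<close>-th level set, and
  summing over \<open>k\<close> under the integral leaves a multiple of the area function.\<close>

lemma weight_sum: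
  "(\<integral>\<^sup>+ a. ennreal (weight a) \<partial>count_space UNIV) \<le> ennreal (8 * ball_const * atom_const) * tent_norm q f"
proof -
  have c: "0 \<le> ball_const * atom_const" using ball_const_pos atom_const_pos by simp
  have "(\<integral>\<^sup>+ a. ennreal (weight a) \<partial>count_space UNIV)
    = (\<integral>\<^sup>+ k. \<integral>\<^sup>+ Q. ennreal (weight (k, Q)) \<partial>count_space UNIV \<partial>count_space UNIV)"
    by (rule nn_integral_fst_count_space[symmetric])
  also have "\<dots> \<le> (\<integral>\<^sup>+ k. ennreal (4 * ball_const * atom_const) * (ennreal (2 powr real_of_int k) * emeasure gauss_measure (level k)) \<partial>count_space UNIV)"
  proof (intro nn_integral_mono)
    fix k
    let ?c = "2 * ball_const * atom_const * 2 powr real_of_int k"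
    have "(\<integral>\<^sup>+ Q. ennreal (weight (k, Q)) \<partial>count_space UNIV)
      \<le> (\<integral>\<^sup>+ Q. ennreal ?c * (ennreal (measure gauss_measure (cube_at Q)) * indicator (top_heavy k) Q) \<partial>count_space UNIV)"
    proof (intro nn_integral_mono)
      fix Q
      show "ennreal (weight (k, Q)) \<le> ennreal ?c * (ennreal (measure gauss_measure (cube_at Q)) * indicator (top_heavy k) Q)"
      proof (cases "Q \<in> top_heavy k")
        case True
        have "weight (k, Q) = atom_const * 2 powr real_of_int (k + 1) * measure gauss_measure (atom_ball Q)"
          using True by (simp add: weight_def)
        also have "\<dots> \<le> atom_const * 2 powr real_of_int (k + 1) * (ball_const * measure gauss_measure (cube_at Q))"
          using atom_const_pos atom_ball(4)[OF top_heavy_tile[OF True]] by (intro mult_left_mono) auto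
        also have "\<dots> = ?c * measure gauss_measure (cube_at Q)"
          by (simp add: powr_add)
        finally have "ennreal (weight (k, Q)) \<le> ennreal (?c * measure gauss_measure (cube_at Q))"
          by (rule ennreal_leI)
        also have "\<dots> = ennreal ?c * ennreal (measure gauss_measure (cube_at Q))"
          using ball_const_pos atom_const_pos by (intro ennreal_mult) auto
        finally show ?thesis using True by simp
      qed (simp add: weight_def)
    qed
    also have "\<dots> = ennreal ?c * (\<integral>\<^sup>+ Q. ennreal (measure gauss_measure (cube_at Q)) * indicator (top_heavy k) Q \<partial>count_space UNIV)"
      by (intro nn_integral_cmult) simp
    also have "\<dots> \<le> ennreal ?c * (2 * emeasure gauss_measure (level k))"
      by (intro mult_left_mono top_heavy_sum) simp
    also have "\<dots> = ennreal (4 * ball_const * atom_const) * (ennreal (2 powr real_of_int k) * emeasure gauss_measure (level k))"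
    proof -
      let ?m = "measure gauss_measure (level k)"
      have "ennreal ?c * (2 * emeasure gauss_measure (level k)) = ennreal ?c * ennreal (2 * ?m)"
        by (simp add: gauss.emeasure_eq_measure ennreal_mult)
      also have "\<dots> = ennreal (?c * (2 * ?m))"
        using ball_const_pos atom_const_pos by (intro ennreal_mult[symmetric]) auto
      also have "?c * (2 * ?m) = 4 * ball_const * atom_const * (2 powr real_of_int k * ?m)"
        by simp
      also have "ennreal \<dots> = ennreal (4 * ball_const * atom_const) * ennreal (2 powr real_of_int k * ?m)"
        using ball_const_pos atom_const_pos by (intro ennreal_mult) auto
      also have "ennreal (2 powr real_of_int k * ?m) = ennreal (2 powr real_of_int k) * emeasure gauss_measure (level k)"
        by (simp add: gauss.emeasure_eq_measure ennreal_mult)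
      finally show ?thesis .
    qed
    finally show "(\<integral>\<^sup>+ Q. ennreal (weight (k, Q)) \<partial>count_space UNIV)
      \<le> ennreal (4 * ball_const * atom_const) * (ennreal (2 powr real_of_int k) * emeasure gauss_measure (level k))" .
  qed
  also have "\<dots> = ennreal (4 * ball_const * atom_const) * (\<integral>\<^sup>+ k. ennreal (2 powr real_of_int k) * emeasure gauss_measure (level k) \<partial>count_space UNIV)"
    by (intro nn_integral_cmult) simp
  also have "(\<integral>\<^sup>+ k. ennreal (2 powr real_of_int k) * emeasure gauss_measure (level k) \<partial>count_space UNIV)
    = (\<integral>\<^sup>+ k. \<integral>\<^sup>+ x. ennreal (2 powr real_of_int k) * indicator (level k) x \<partial>gauss_measure \<partial>count_space UNIV)"
    by (intro nn_integral_cong nn_integral_cmult_indicator[symmetric]) simp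
  also have "\<dots> = (\<integral>\<^sup>+ x. \<integral>\<^sup>+ k. ennreal (2 powr real_of_int k) * indicator (level k) x \<partial>count_space UNIV \<partial>gauss_measure)"
    by (rule nn_integral_count_space_nn_integral[symmetric]) auto
  also have "\<dots> \<le> (\<integral>\<^sup>+ x. 2 * area_root x \<partial>gauss_measure)"
  proof (intro nn_integral_mono)
    fix x
    have "indicator (level k) x = (indicator {k. ennreal (2 powr real_of_int k) < area_root x} k :: ennreal)" for k
      by (simp add: level_def indicator_def)
    then show "(\<integral>\<^sup>+ k. ennreal (2 powr real_of_int k) * indicator (level k) x \<partial>count_space UNIV) \<le> 2 * area_root x"
      using dyadic_sum_le[of "area_root x"] by simp
  qed
  also have "\<dots> = 2 * tent_norm q f"
    unfolding tent_norm_area_root by (rule nn_integral_cmult) simp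
  finally have "(\<integral>\<^sup>+ a. ennreal (weight a) \<partial>count_space UNIV) \<le> ennreal (4 * ball_const * atom_const) * (2 * tent_norm q f)"
    by (simp add: mult_left_mono)
  also have "\<dots> = ennreal (4 * ball_const * atom_const) * ennreal 2 * tent_norm q f" by (simp add: mult.assoc)
  also have "ennreal (4 * ball_const * atom_const) * ennreal 2 = ennreal (8 * ball_const * atom_const)"
    using c by (simp add: ennreal_mult[symmetric] mult.assoc del: ennreal_numeral)
  finally show ?thesis .
qed

section \<open>Convergence of the decomposition\<close>

lemma area_root_AE_finite: "AE x in gauss_measure. area_root x \<noteq> top"
proof (rule nn_integral_PInf_AE[simplified])
  show "(\<integral>\<^sup>+ x. area_root x \<partial>gauss_measure) \<noteq> top"
    using tent_norm_finite[OF f q] by (simp add: tent_norm_area_root less_top)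
qed simp

text \<open>A tile heavy for all \<open>k\<close> would contain a set of at least half its measure on which the area
  function is infinite, by continuity from above as \<open>k\<close> tends to infinity.\<close>

lemma not_always_heavy:
  assumes p: "p \<in> tent_domain"
  shows "\<exists>k. tile N p \<notin> heavy k"
proof (rule ccontr)
  assume "\<not> ?thesis"
  then have h: "tile N p \<in> heavy k" for k by simp
  let ?T = "cube_at (tile N p)"
  define A where "A n = ?T \<inter> level (int n)" for n
  have dec: "decseq A"
  proof (rule decseq_SucI)
    show "A (Suc n) \<subseteq> A n" for n
      using level_antimono[of "int n" "int (Suc n)"] by (auto simp: A_def)
  qed
  have "(\<lambda>n. measure gauss_measure (A n)) \<longlonglongrightarrow> measure gauss_measure (\<Inter>n. A n)"
    by (rule gauss.finite_Lim_measure_decseq[OF _ dec]) (auto simp: A_def)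
  moreover have "measure gauss_measure (\<Inter>n. A n) = 0"
  proof -
    have "(\<Inter>n. A n) \<subseteq> {x. area_root x = top}"
    proof
      fix x assume "x \<in> (\<Inter>n. A n)"
      then have x: "ennreal (2 powr real n) < area_root x" for n by (auto simp: A_def level_def)
      show "x \<in> {x. area_root x = top}"
      proof (cases "area_root x")
        case (real r)
        obtain n where "r < 2 ^ n" using real_arch_pow[of 2 r] by auto
        then show ?thesis using x[of n] real by (simp add: powr_realpow ennreal_less_iff)
      qed simp
    qed
    then have "AE x in gauss_measure. x \<notin> (\<Inter>n. A n)"
      using area_root_AE_finite by (auto elim!: eventually_mono)
    then show ?thesis
      by (subst (asm) AE_iff_null_sets[symmetric]) (auto simp: A_def null_sets_def measure_def)
  qed
  moreover have "measure gauss_measure ?T / 2 \<le> measure gauss_measure (A n)" for n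
    using h[of "int n"] by (simp add: heavy_def A_def)
  ultimately have "measure gauss_measure ?T / 2 \<le> 0"
    by (metis LIMSEQ_le_const)
  then show False using tile_cube_pos[of "tile N p"] p by simp
qed

text \<open>If a tile is light for all \<open>k\<close>, letting \<open>k\<close> tend to minus infinity shows that at least half of
  it lies in the zero set of the area function, and \<open>tile_Carleson\<close> with \<open>U = {A > 0}\<close> has a
  vanishing right-hand side.\<close>

lemma zero_off_heavy:
  "AE p in tent_measure. (\<forall>k. tile N p \<notin> heavy k) \<longrightarrow> f p = 0"
proof -
  define V where "V = tent_domain \<inter> {p. tile N p \<in> {Q. \<forall>k. Q \<notin> heavy k}}"
  define U where "U = {x. area_root x \<noteq> 0}"
  have V: "V \<in> sets borel" "V \<subseteq> tent_domain"
    unfolding V_def using tile_measurable[of N "{Q. \<forall>k. Q \<notin> heavy k}"] by auto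
  have U: "U \<in> sets borel"
  proof -
    have "U = {x \<in> space borel. area_root x \<noteq> 0}" by (simp add: U_def)
    also have "\<dots> \<in> sets borel" by measurable
    finally show ?thesis .
  qed
  have half: "measure gauss_measure (cube_at (tile N p)) \<le> 2 * measure gauss_measure (cube_at (tile N p) - U)"
    if p: "p \<in> V" for p
  proof -
    let ?T = "cube_at (tile N p)"
    define A where "A n = ?T - level (- int n)" for n
    have dec: "decseq A"
    proof (rule decseq_SucI)
      show "A (Suc n) \<subseteq> A n" for n
        using level_antimono[of "- int (Suc n)" "- int n"] by (auto simp: A_def)
    qed
    have "(\<lambda>n. measure gauss_measure (A n)) \<longlonglongrightarrow> measure gauss_measure (\<Inter>n. A n)"
      by (rule gauss.finite_Lim_measure_decseq[OF _ dec]) (auto simp: A_def)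
    moreover have "measure gauss_measure ?T / 2 \<le> measure gauss_measure (A n)" for n
      using not_heavy_half[of p "- int n"] p by (simp add: V_def A_def)
    ultimately have "measure gauss_measure ?T / 2 \<le> measure gauss_measure (\<Inter>n. A n)"
      by (metis LIMSEQ_le_const)
    also have "(\<Inter>n. A n) \<subseteq> ?T - U"
    proof
      fix x assume "x \<in> (\<Inter>n. A n)"
      then have x: "x \<in> ?T" "\<And>n. area_root x \<le> ennreal (2 powr (- real n))"
        by (auto simp: A_def level_def not_less)
      have "area_root x = 0"
      proof (rule ccontr)
        assume "area_root x \<noteq> 0"
        moreover have "area_root x \<noteq> top" using x(2)[of 0] by (auto simp: top_unique)
        ultimately obtain r where r: "area_root x = ennreal r" "0 < r"
          by (cases "area_root x") (auto simp: less_le)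
        \<comment> \<open>A positive value \<open>r\<close> of the area function exceeds some \<open>2 powr (- real n)\<close>.\<close>
        obtain n where "1 / r < 2 ^ n" using real_arch_pow[of 2 "1 / r"] by auto
        then have "2 powr (- real n) < r"
          using r by (simp add: powr_minus powr_realpow field_simps)
        then show False using x(2)[of n] r by (simp add: ennreal_le_iff)
      qed
      then show "x \<in> ?T - U" using x by (simp add: U_def)
    qed
    then have "measure gauss_measure (\<Inter>n. A n) \<le> measure gauss_measure (?T - U)"
      using U by (intro gauss.finite_measure_mono) auto
    finally show ?thesis by simp
  qed
  have "(\<integral>\<^sup>+ p. ennreal (norm (f p) powr q) * indicator V p \<partial>tent_measure)
    \<le> ennreal (2 * ball_const) * (\<integral>\<^sup>+ x. tent_area q f x * indicator (UNIV - U) x \<partial>gauss_measure)"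
    using V U half by (intro tile_Carleson f_measurable) auto
  also have "(\<integral>\<^sup>+ x. tent_area q f x * indicator (UNIV - U) x \<partial>gauss_measure)
      = (\<integral>\<^sup>+ x. 0 \<partial>(gauss_measure :: (real ^ 'n) measure))"
    using q by (intro nn_integral_cong) (auto simp: U_def area_root_def epowr_eq_0_iff split: split_indicator)
  finally have "(\<integral>\<^sup>+ p. ennreal (norm (f p) powr q) * indicator V p \<partial>tent_measure) = 0" by simp
  moreover have [measurable]: "Measurable.pred tent_measure (\<lambda>p. p \<in> V)"
    using measurable_compose[OF id_measurable_tent, of "\<lambda>p. p \<in> V" "count_space UNIV"] V by simp
  ultimately have "AE p in tent_measure. ennreal (norm (f p) powr q) * indicator V p = 0"
    by (subst (asm) nn_integral_0_iff_AE) (auto simp: indicator_def)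
  moreover have "AE p in tent_measure. p \<in> tent_domain"
    by (rule AE_I2) simp
  ultimately show ?thesis
    by eventually_elim (auto simp: V_def)
qed

text \<open>Heaviness is monotone in \<open>k\<close>, so a tile that is heavy for some \<open>k\<close> but not for all of them has a
  last \<open>k\<close> for which it is heavy, and its points then belong to a piece.\<close>

lemma zero_off_pieces:
  "AE p in tent_measure. (\<forall>a. p \<notin> piece a) \<longrightarrow> f p = 0"
proof -
  have "AE p in tent_measure. p \<in> tent_domain"
    by (rule AE_I2) simp
  with zero_off_heavy show ?thesis
  proof eventually_elim
    case (elim p)
    show ?case
    proof (intro impI)
      assume off: "\<forall>a. p \<notin> piece a"
      have "tile N p \<notin> heavy k" for k
      proof
        assume k: "tile N p \<in> heavy k"
        have step: "tile N p \<in> heavy (l + 1)" if "tile N p \<in> heavy l" for l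
          using piece_cover[OF elim(2) that] off by blast
        have up: "tile N p \<in> heavy l" if "k \<le> l" for l
          using that by (induction l rule: int_ge_induct) (use k step in auto)
        obtain l where "tile N p \<notin> heavy l" using not_always_heavy[OF elim(2)] by blast
        then show False using up[of l] heavy_antimono[of l k] k by (cases "k \<le> l") auto
      qed
      then show "f p = 0" using elim(1) by blast
    qed
  qed
qed

text \<open>Dominated convergence is used twice, first in the cone at \<open>x\<close>, where the area integral of \<open>f\<close> is
  finite for almost every \<open>x\<close>, and then in \<open>x\<close>.\<close>

lemma tail_tendsto_0:
  fixes e :: "nat \<Rightarrow> int \<times> nat \<times> (int ^ 'n)"
  assumes e: "surj e"
  defines "R \<equiv> \<lambda>M p. if p \<in> (\<Union>j<M. piece (e j)) then 0 else f p"
  shows "(\<lambda>M. tent_norm q (R M)) \<longlonglongrightarrow> 0"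
proof -
  have [measurable]: "R M \<in> borel_measurable tent_measure" for M
  proof -
    have "(\<Union>j<M. piece (e j)) \<in> sets borel" by auto
    then have [measurable]: "Measurable.pred tent_measure (\<lambda>p. p \<in> (\<Union>j<M. piece (e j)))"
      using measurable_compose[OF id_measurable_tent, of "\<lambda>p. p \<in> (\<Union>j<M. piece (e j))" "count_space UNIV"] by simp
    show ?thesis unfolding R_def by measurable
  qed
  have le: "norm (R M p) \<le> norm (f p)" for M p by (simp add: R_def)
  have area: "(\<lambda>M. tent_area q (R M) x) \<longlonglongrightarrow> 0" if x: "area_root x \<noteq> top" for x
  proof -
    have "(\<lambda>M. tent_area q (R M) x) \<longlonglongrightarrow> (\<integral>\<^sup>+ p. 0 \<partial>(tent_measure :: ((real ^ 'n) \<times> real) measure))"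
      unfolding tent_area_kernel
    proof (rule nn_integral_dominated_convergence)
      show "AE p in tent_measure. ennreal (area_kernel x p * norm (R M p) powr q) \<le> ennreal (area_kernel x p * norm (f p) powr q)" for M
        using le q by (intro AE_I2 ennreal_leI mult_left_mono powr_mono2 area_kernel_nonneg) auto
      show "(\<integral>\<^sup>+ p. ennreal (area_kernel x p * norm (f p) powr q) \<partial>tent_measure) < \<infinity>"
        using x by (cases "tent_area q f x = top")
          (simp_all add: area_root_def tent_area_kernel[symmetric] less_top)
      show "AE p in tent_measure. (\<lambda>M. ennreal (area_kernel x p * norm (R M p) powr q)) \<longlonglongrightarrow> 0"
        using zero_off_pieces
      proof eventually_elim
        case (elim p)
        have "eventually (\<lambda>M. R M p = 0) sequentially"
        proof (cases "\<exists>a. p \<in> piece a")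
          case True
          then obtain j where "p \<in> piece (e j)" using e by (metis surjD)
          then show ?thesis
            by (intro eventually_sequentiallyI[of "Suc j"]) (auto simp: R_def)
        next
          case False
          then show ?thesis using elim by (simp add: R_def)
        qed
        then show ?case
          by (intro tendsto_eventually) (auto elim!: eventually_mono)
      qed
    qed measurable
    then show ?thesis by simp
  qed
  have "(\<lambda>M. tent_norm q (R M)) \<longlonglongrightarrow> (\<integral>\<^sup>+ x. 0 \<partial>(gauss_measure :: (real ^ 'n) measure))"
    unfolding tent_norm_area
  proof (rule nn_integral_dominated_convergence)
    show "AE x in gauss_measure. epowr (tent_area q (R M) x) (1 / q) \<le> area_root x" for M
      unfolding area_root_def using le q by (intro AE_I2 epowr_mono tent_area_mono) auto
    show "(\<integral>\<^sup>+ x. area_root x \<partial>gauss_measure) < \<infinity>"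
      using tent_norm_finite[OF f q] by (simp add: tent_norm_area_root)
    show "AE x in gauss_measure. (\<lambda>M. epowr (tent_area q (R M) x) (1 / q)) \<longlonglongrightarrow> 0"
      using area_root_AE_finite by eventually_elim (intro epowr_root_tendsto_0 area q)
  qed measurable
  then show ?thesis by simp
qed

lemma atomic_decomposition:
  "\<exists>(c :: nat \<Rightarrow> complex) (a :: nat \<Rightarrow> (real ^ 'n) \<times> real \<Rightarrow> complex).
       summable (\<lambda>k. norm (c k)) \<and>
       (\<forall>k. tent_atom q \<alpha> (a k)) \<and>
       tent_sums q (\<lambda>k p. c k * a k p) f \<and>
       ennreal (\<Sum>k. norm (c k)) \<le> ennreal (8 * ball_const * atom_const) * tent_norm q f"
proof -
  have inf: "infinite (UNIV :: (int \<times> nat \<times> (int ^ 'n)) set)"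
    by (simp add: finite_prod)
  define e where "e = from_nat_into (UNIV :: (int \<times> nat \<times> (int ^ 'n)) set)"
  have e: "bij e"
    unfolding e_def by (rule bij_betw_from_nat_into[OF _ inf]) simp
  define c :: "nat \<Rightarrow> complex" where "c j = of_real (weight (e j))" for j
  have norm_c: "norm (c j) = weight (e j)" for j by (simp add: c_def weight_nonneg)
  have ca: "c j * atom (e j) p = (if p \<in> piece (e j) then f p else 0)" for j p
    by (simp add: c_def weight_atom)
  have "(\<Sum>j. ennreal (norm (c j))) = (\<integral>\<^sup>+ j. ennreal (weight (e j)) \<partial>count_space UNIV)"
    by (simp add: nn_integral_count_space_nat norm_c)
  also have "\<dots> = (\<integral>\<^sup>+ a. ennreal (weight a) \<partial>count_space UNIV)"
    by (rule nn_integral_bij_count_space[OF e])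
  also have "\<dots> \<le> ennreal (8 * ball_const * atom_const) * tent_norm q f" by (rule weight_sum)
  finally have sum: "(\<Sum>j. ennreal (norm (c j))) \<le> ennreal (8 * ball_const * atom_const) * tent_norm q f" .
  also have "\<dots> < top" using tent_norm_finite[OF f q] by (simp add: ennreal_mult_less_top)
  finally have summ: "summable (\<lambda>j. norm (c j))"
    by (intro summable_suminf_not_top) auto
  have "(\<Sum>j. ennreal (norm (c j))) = ennreal (\<Sum>j. norm (c j))"
    using summ by (intro suminf_ennreal2) auto
  with sum have bound: "ennreal (\<Sum>j. norm (c j)) \<le> ennreal (8 * ball_const * atom_const) * tent_norm q f" by simp
  \<comment> \<open>As the pieces are disjoint, a partial sum is the restriction of \<open>f\<close> to a finite union of them.\<close>
  have partial_sum: "(\<Sum>j<M. c j * atom (e j) p) = (if p \<in> (\<Union>j<M. piece (e j)) then f p else 0)" for M p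
  proof (induction M)
    case (Suc M)
    have "p \<notin> (\<Union>j<M. piece (e j))" if "p \<in> piece (e M)"
    proof
      assume "p \<in> (\<Union>j<M. piece (e j))"
      then obtain j where "j < M" "p \<in> piece (e j)" by auto
      with piece_disjoint[OF this(2) that] e show False by (auto simp: bij_def inj_def)
    qed
    moreover have "(\<Sum>j<Suc M. c j * atom (e j) p)
      = (if p \<in> (\<Union>j<M. piece (e j)) then f p else 0) + (if p \<in> piece (e M) then f p else 0)"
      by (simp only: sum.lessThan_Suc Suc) (simp only: ca)
    moreover have "(\<Union>j<Suc M. piece (e j)) = (\<Union>j<M. piece (e j)) \<union> piece (e M)"
      by (auto simp: less_Suc_eq)
    ultimately show ?case by auto
  qed simp
  have "tent_sums q (\<lambda>j p. c j * atom (e j) p) f"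
    unfolding tent_sums_def
  proof (intro conjI allI f)
    show "(\<lambda>p. c j * atom (e j) p) \<in> tent_space q" for j
      unfolding ca by (intro tent_space_restrict f q piece_sets)
    have "(\<lambda>p. f p - (\<Sum>j<M. c j * atom (e j) p)) = (\<lambda>p. if p \<in> (\<Union>j<M. piece (e j)) then 0 else f p)" for M
      by (auto simp: partial_sum)
    then show "(\<lambda>M. tent_norm q (\<lambda>p. f p - (\<Sum>j<M. c j * atom (e j) p))) \<longlonglongrightarrow> 0"
      using tail_tendsto_0[of e] e by (simp add: bij_def)
  qed
  with summ bound show ?thesis
    by (intro exI[of _ c] exI[of _ "\<lambda>j. atom (e j)"]) (simp add: tent_atom_atom)
qed

end

theorem theorem3p4:
  fixes q \<alpha> :: real
  assumes "1 < q" and "1 < \<alpha>"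
  shows "\<exists>C>0. \<forall>f :: (real ^ 'n) \<times> real \<Rightarrow> complex. f \<in> tent_space q \<longrightarrow>
    (\<exists>(c :: nat \<Rightarrow> complex) (a :: nat \<Rightarrow> (real ^ 'n) \<times> real \<Rightarrow> complex).
       summable (\<lambda>k. norm (c k)) \<and>
       (\<forall>k. tent_atom q \<alpha> (a k)) \<and>
       tent_sums q (\<lambda>k p. c k * a k p) f \<and>
       ennreal (\<Sum>k. norm (c k)) \<le> ennreal C * tent_norm q f)"
proof -
  define m where "m = min 1 (\<alpha> - 1)"
  have m: "0 < m" using assms by (simp add: m_def)
  obtain N where "4 * real CARD('n) / m < 2 ^ N"
    using real_arch_pow[of 2 "4 * real CARD('n) / m"] by auto
  then have N: "4 * real CARD('n) / 2 ^ N \<le> min 1 (\<alpha> - 1)"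
    using m unfolding m_def[symmetric] by (simp add: field_simps)
  \<comment> \<open>This is the doubling constant, which is the same for all \<open>f\<close>.\<close>
  define K where "K = exp (\<alpha> * (2 + \<alpha>)) * (2 * (2 ^ N + real CARD('n))) ^ CARD('n)"
  have K: "0 < K" by (simp add: K_def add_pos_nonneg)
  show ?thesis
  proof (intro exI[of _ "8 * K * (2 * K) powr (1 / q)"] conjI allI impI)
    show "0 < 8 * K * (2 * K) powr (1 / q)" using K by simp
    fix f :: "(real ^ 'n) \<times> real \<Rightarrow> complex"
    assume "f \<in> tent_space q"
    with assms N interpret tent_decomposition \<alpha> N q f
      by unfold_locales
    show "\<exists>(c :: nat \<Rightarrow> complex) (a :: nat \<Rightarrow> (real ^ 'n) \<times> real \<Rightarrow> complex).
       summable (\<lambda>k. norm (c k)) \<and>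
       (\<forall>k. tent_atom q \<alpha> (a k)) \<and>
       tent_sums q (\<lambda>k p. c k * a k p) f \<and>
       ennreal (\<Sum>k. norm (c k)) \<le> ennreal (8 * K * (2 * K) powr (1 / q)) * tent_norm q f"
      using atomic_decomposition unfolding atom_const_def ball_const_def K_def .
  qed
qed

end
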